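(* Let $N\geq 2$, and let $\{C_j\}_{j\in J}$ be a family of compact contractible topological $N$-manifolds with connected boundaries. Suppose that the boundaries $\partial C_j$ are mutually homotopy equivalent and pairwise not topologically $h$-cobordant. Then the interiors $\operatorname{int}(C_j)$ are mutually properly homotopy equivalent and pairwise nonhomeomorphic.
   Context: A continuous map between locally compact Hausdorff spaces is proper if preimages of compact sets are compact. Two such spaces are properly homotopy equivalent if there are proper maps in both directions whose composites are homotopic to the identities through proper homotopies (homotopies that are proper as maps from the product with $[0,1]$). Two closed topological manifolds $Y_0,Y_1$ of the same dimension $n$ are topologically $h$-cobordant if there is a compact topological $(n+1)$-manifold $W$ with $\partial W\cong Y_0\sqcup Y_1$ such that both inclusions $Y_0\hookrightarrow W$ and $Y_1\hookrightarrow W$ are homotopy equivalences (no condition on Whitehead torsion or orientations). *)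

theory Defs
  imports "HOL-Analysis.Analysis"
begin

section \<open>Topological manifolds with boundary\<close>

text \<open>For \<open>n = 0\<close> the half-space is all of the one-point space \<^term>\<open>Euclidean_space 0\<close>,
  so 0-manifolds have empty boundary.\<close>

definition Euclidean_half_space :: "nat \<Rightarrow> (nat \<Rightarrow> real) topology" where
  "Euclidean_half_space n = subtopology (Euclidean_space n) {x. 0 \<le> x 0}"

definition topological_manifold :: "nat \<Rightarrow> 'a topology \<Rightarrow> bool" where
  "topological_manifold n M \<longleftrightarrow>
     Hausdorff_space M \<and> second_countable M \<and>
     (\<forall>p \<in> topspace M. \<exists>U V. openin M U \<and> p \<in> U \<and> openin (Euclidean_half_space n) V \<and>
        subtopology M U homeomorphic_space subtopology (Euclidean_half_space n) V)"

definition manifold_interior :: "nat \<Rightarrow> 'a topology \<Rightarrow> 'a set" where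
  "manifold_interior n M =
     {p \<in> topspace M. \<exists>U V. openin M U \<and> p \<in> U \<and> openin (Euclidean_space n) V \<and>
        subtopology M U homeomorphic_space subtopology (Euclidean_space n) V}"

definition manifold_boundary :: "nat \<Rightarrow> 'a topology \<Rightarrow> 'a set" where
  "manifold_boundary n M = topspace M - manifold_interior n M"

definition closed_manifold :: "nat \<Rightarrow> 'a topology \<Rightarrow> bool" where
  "closed_manifold n M \<longleftrightarrow>
     topological_manifold n M \<and> compact_space M \<and> manifold_boundary n M = {}"


section \<open>Homotopy equivalences and h-cobordism\<close>

definition homotopy_equivalence_map :: "'a topology \<Rightarrow> 'b topology \<Rightarrow> ('a \<Rightarrow> 'b) \<Rightarrow> bool" where
  "homotopy_equivalence_map X Y f \<longleftrightarrow>
     continuous_map X Y f \<and>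
     (\<exists>g. continuous_map Y X g \<and>
        homotopic_with (\<lambda>_. True) X X (g \<circ> f) id \<and>
        homotopic_with (\<lambda>_. True) Y Y (f \<circ> g) id)"

lemma homotopy_equivalent_space_iff_map:
  "X homotopy_equivalent_space Y \<longleftrightarrow> (\<exists>f. homotopy_equivalence_map X Y f)"
  unfolding homotopy_equivalent_space_def homotopy_equivalence_map_def by blast

text \<open>A definition cannot quantify over the type carrying the cobordism \<open>W\<close>. The type
  \<^typ>\<open>nat \<Rightarrow> real\<close> is no restriction: \<open>W\<close> may be any topology on any of its subsets, and every
  second countable Hausdorff space has a homeomorphic copy there.\<close>

lemma second_countable_Hausdorff_homeomorphic_copy:
  fixes X :: "'a topology"
  assumes "second_countable X" "Hausdorff_space X"
  shows "\<exists>W :: (nat \<Rightarrow> real) topology. X homeomorphic_space W"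
proof -
  obtain \<B> where \<B>: "countable \<B>" "\<And>V. V \<in> \<B> \<Longrightarrow> openin X V"
      "\<And>U x. openin X U \<Longrightarrow> x \<in> U \<Longrightarrow> \<exists>V \<in> \<B>. x \<in> V \<and> V \<subseteq> U"
    using assms(1) unfolding second_countable_def by metis
  define f :: "'a \<Rightarrow> nat \<Rightarrow> real" where
    "f x n = (if \<exists>V \<in> \<B>. to_nat_on \<B> V = n \<and> x \<in> V then 1 else 0)" for x n
  have mem: "f x (to_nat_on \<B> V) = 1 \<longleftrightarrow> x \<in> V" if "V \<in> \<B>" for x V
    using that \<B>(1) inj_on_to_nat_on[OF \<B>(1)] unfolding f_def inj_on_def by auto
  have inj: "inj_on f (topspace X)"
  proof (rule inj_onI, rule ccontr)
    fix x y assume xy: "x \<in> topspace X" "y \<in> topspace X" "f x = f y" "x \<noteq> y"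
    then obtain U where U: "openin X U" "x \<in> U" "y \<notin> U"
      using assms(2) unfolding Hausdorff_space_def disjnt_iff by metis
    then obtain V where "V \<in> \<B>" "x \<in> V" "V \<subseteq> U"
      using \<B>(3) by blast
    then show False
      using mem[of V x] mem[of V y] xy(3) U(3) by auto
  qed
  define g where "g = inv_into (topspace X) f"
  define W where "W = pullback_topology (f ` topspace X) g X"
  have gf: "g (f x) = x" if "x \<in> topspace X" for x
    using inj that unfolding g_def by simp
  have tW: "topspace W = f ` topspace X"
    unfolding W_def topspace_pullback_topology using gf by auto
  have cg: "continuous_map W X g"
    unfolding W_def by (rule continuous_map_pullback[of X X id, simplified]) 
  have cf: "continuous_map X W f"
    unfolding W_def
  proof (rule continuous_map_pullback')
    show "continuous_map X X (g \<circ> f)"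
      by (rule continuous_map_eq[OF continuous_map_id]) (simp add: gf)
    show "topspace X \<subseteq> f -` f ` topspace X"
      by auto
  qed
  have "homeomorphic_maps X W f g"
    unfolding homeomorphic_maps_def using cf cg gf tW by auto
  then show ?thesis
    unfolding homeomorphic_space_def by blast
qed

definition h_cobordant :: "nat \<Rightarrow> 'a topology \<Rightarrow> 'a topology \<Rightarrow> bool" where
  "h_cobordant n Y0 Y1 \<longleftrightarrow>
     closed_manifold n Y0 \<and> closed_manifold n Y1 \<and>
     (\<exists>(W :: (nat \<Rightarrow> real) topology) \<phi>.
        topological_manifold (n + 1) W \<and> compact_space W \<and>
        homeomorphic_map (sum_topology (\<lambda>b. if b then Y1 else Y0) UNIV)
          (subtopology W (manifold_boundary (n + 1) W)) \<phi> \<and>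
        homotopy_equivalence_map Y0 W (\<lambda>y. \<phi> (False, y)) \<and>
        homotopy_equivalence_map Y1 W (\<lambda>y. \<phi> (True, y)))"


section \<open>Proper homotopy equivalence\<close>

definition proper_continuous_map :: "'a topology \<Rightarrow> 'b topology \<Rightarrow> ('a \<Rightarrow> 'b) \<Rightarrow> bool" where
  "proper_continuous_map X Y f \<longleftrightarrow>
     continuous_map X Y f \<and>
     (\<forall>K. compactin Y K \<longrightarrow> compactin X {x \<in> topspace X. f x \<in> K})"

lemma proper_continuous_map_iff_proper_map:
  assumes "locally_compact_space Y" "Hausdorff_space Y"
  shows "proper_continuous_map X Y f \<longleftrightarrow> continuous_map X Y f \<and> proper_map X Y f"
proof -
  have "k_space Y" "kc_space Y"
    using assms by (simp_all add: locally_compact_imp_k_space Hausdorff_imp_kc_space)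
  then show ?thesis
    unfolding proper_continuous_map_def
    using compact_imp_proper_map[of Y f X] compactin_proper_map_preimage[of X Y f]
      continuous_map_funspace[of X Y f] by blast
qed

text \<open>Unlike in \<^term>\<open>homotopic_with P\<close>, which constrains only the individual stages of a
  homotopy, properness is required of the homotopy as a map on the product.\<close>

definition properly_homotopic ::
    "'a topology \<Rightarrow> 'b topology \<Rightarrow> ('a \<Rightarrow> 'b) \<Rightarrow> ('a \<Rightarrow> 'b) \<Rightarrow> bool" where
  "properly_homotopic X Y f g \<longleftrightarrow>
     (\<exists>h. proper_continuous_map (prod_topology (top_of_set {0..1::real}) X) Y h \<and>
        (\<forall>x \<in> topspace X. h (0, x) = f x) \<and>
        (\<forall>x \<in> topspace X. h (1, x) = g x))"

definition properly_homotopy_equivalent_space :: "'a topology \<Rightarrow> 'b topology \<Rightarrow> bool" where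
  "properly_homotopy_equivalent_space X Y \<longleftrightarrow>
     (\<exists>f g. proper_continuous_map X Y f \<and> proper_continuous_map Y X g \<and>
        properly_homotopic X X (g \<circ> f) id \<and>
        properly_homotopic Y Y (f \<circ> g) id)"

end

theory Submission
  imports Defs "HOL-Homology.Invariance_of_Domain"
begin

text \<open>The engine is Brown's collar theorem: attach an external collar to \<open>\<partial>M\<close> and absorb it into \<open>M\<close>
  by finitely many stretchings along local collars (Connelly).

  For the proper homotopy equivalences, a homotopy equivalence of boundaries extends over the
  \<open>C\<^sub>j\<close> because the targets are contractible, and so do the homotopies from the composites to the
  identity. Pushing inwards along the collar, one arranges that exactly the boundary is mapped to the
  boundary. By compactness, such a map restricts to a proper map of the interiors.

  If the interiors are homeomorphic, then both boundaries collar the end of one and the same space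
  \<open>Z\<close>, and the region between a level of the one collar and a farther level of the other is an
  h-cobordism. The tails beyond such levels are nested alternately, so the two-out-of-six property of
  homotopy equivalences shows that each inclusion of a level is one.\<close>

text \<open>Local collars do not fit together, so no global collar is written down directly. The
  height of the external collar is raised from 0 to 1 through partial sums of normalised bump
  functions on the boundary; each increment lives inside one local collar, where changing the height
  only reparametrises segments. The boundary is the complement of the points with Euclidean charts.
  That a point on the wall of a half-space chart has no Euclidean chart is invariance of domain; all
  further recognition of boundary points composes germs of homeomorphisms. An extension over a
  contractible target may meet the boundary of the target at interior points, which would destroy
  properness. Hence homotopies are built as homotopies of pairs and then pushed inwards by an amount
  that vanishes exactly where the given values must be kept. Levels of two collars of one end need
  not be parallel, so the region between them has no visible product structure. It is compared with
  the tail containing it, which retracts onto it by pushing the farther tail back to its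
  level.\<close>

lemma continuous_map_in: "continuous_map X Y f \<Longrightarrow> x \<in> topspace X \<Longrightarrow> f x \<in> topspace Y"
  using continuous_map_funspace by fast

section \<open>Composition and gluing of continuous maps\<close>

lemma continuous_map_compose_app:
  assumes "continuous_map Y Z g" "continuous_map X Y f"
  shows "continuous_map X Z (\<lambda>x. g (f x))"
  using continuous_map_compose[OF assms(2,1)] by (simp add: o_def)

lemma continuous_map_compose_pair:
  assumes "continuous_map (prod_topology Y Y') Z h" "continuous_map X Y f" "continuous_map X Y' g"
  shows "continuous_map X Z (\<lambda>x. h (f x, g x))"
  using continuous_map_compose_app[OF assms(1), of X "\<lambda>x. (f x, g x)"] assms(2,3)
  by (simp add: continuous_map_paired)

lemma continuous_map_open_cover2:
  assumes "openin X S" "openin X T" "topspace X \<subseteq> S \<union> T"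
    and "continuous_map (subtopology X S) Y f" "continuous_map (subtopology X T) Y f"
  shows "continuous_map X Y f"
proof (rule pasting_lemma[where I = UNIV and T = "\<lambda>b. if b then S else T" and f = "\<lambda>_. f"])
  show "\<exists>j. j \<in> UNIV \<and> x \<in> (if j then S else T) \<and> f x = f x" if "x \<in> topspace X" for x
    using that assms(3) by (metis UNIV_I UnE subsetD)
qed (use assms in \<open>auto split: if_splits\<close>)

section \<open>Collars\<close>

text \<open>\<open>M\<close> is the slice at height 0. The height \<open>f\<close> of the external
  collar varies over \<open>D\<close>, so that the collar can grow a little at a time.\<close>

definition collar_extension :: "'a topology \<Rightarrow> 'a set \<Rightarrow> ('a \<Rightarrow> real) \<Rightarrow> ('a \<times> real) topology" where
  "collar_extension M D f =
     subtopology (prod_topology M euclideanreal) {(x, s). s = 0 \<or> x \<in> D \<and> 0 \<le> s \<and> s \<le> f x}"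

text \<open>Each point of \<open>D\<close> must go to the outer end of its own fibre; this makes the
  homeomorphism composable with a further change of height that respects the fibres.\<close>

definition collared :: "'a topology \<Rightarrow> 'a set \<Rightarrow> ('a \<Rightarrow> real) \<Rightarrow> bool" where
  "collared M D f \<longleftrightarrow>
     (\<exists>G. homeomorphic_map M (collar_extension M D f) G \<and> (\<forall>x \<in> D. G x = (x, f x)))"

text \<open>\<open>k\<close> is a homeomorphism from \<open>U\<close> times \<open>[0,1)\<close>
  onto the open set \<open>B\<close>; its inverse is split into the foot point \<open>\<rho>\<close>
  and the depth \<open>d\<close>.\<close>

definition local_collar ::
    "'a topology \<Rightarrow> 'a set \<Rightarrow> 'a set \<Rightarrow> 'a set \<Rightarrow> ('a \<times> real \<Rightarrow> 'a) \<Rightarrow> ('a \<Rightarrow> 'a) \<Rightarrow> ('a \<Rightarrow> real) \<Rightarrow> bool" where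
  "local_collar M D U B k \<rho> d \<longleftrightarrow>
     openin M B \<and> U = B \<inter> D \<and>
     continuous_map (prod_topology (subtopology M U) (top_of_set {0..<1})) (subtopology M B) k \<and>
     continuous_map (subtopology M B) (subtopology M U) \<rho> \<and>
     continuous_map (subtopology M B) (top_of_set {0..<1}) d \<and>
     (\<forall>x \<in> U. k (x, 0) = x) \<and>
     (\<forall>x \<in> U. \<forall>t \<in> {0..<1}. \<rho> (k (x, t)) = x \<and> d (k (x, t)) = t) \<and>
     (\<forall>y \<in> B. k (\<rho> y, d y) = y)"

text \<open>An increasing bijection from \<open>[-a, 1/2]\<close> onto \<open>[-b, 1/2]\<close>, extended by the identity.\<close>

definition stretch :: "real \<Rightarrow> real \<Rightarrow> real \<Rightarrow> real" where
  "stretch a b t = t - max 0 (1/2 - t) * (b - a) / (1/2 + a)"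

lemma stretch_same [simp]: "stretch a a t = t"
  by (simp add: stretch_def)

lemma stretch_ge_half [simp]: "t \<ge> 1/2 \<Longrightarrow> stretch a b t = t"
  by (simp add: stretch_def)

lemma stretch_lower [simp]: "0 \<le> a \<Longrightarrow> stretch a b (- a) = - b"
  by (simp add: stretch_def divide_simps)

lemma stretch_alt: "0 \<le> a \<Longrightarrow> t \<le> 1/2 \<Longrightarrow> stretch a b t = 1/2 - (1/2 - t) * (1/2 + b) / (1/2 + a)"
  by (simp add: stretch_def field_simps)

lemma stretch_le_half: "0 \<le> a \<Longrightarrow> 0 \<le> b \<Longrightarrow> t \<le> 1/2 \<Longrightarrow> stretch a b t \<le> 1/2"
  by (simp add: stretch_alt)

lemma stretch_inverse:
  assumes "0 \<le> a" "0 \<le> b"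
  shows "stretch b a (stretch a b t) = t"
proof (cases "t \<ge> 1/2")
  case False
  then have "stretch a b t \<le> 1/2"
    using assms stretch_le_half[of a b t] by simp
  then have "stretch b a (stretch a b t) = 1/2 - (1/2 - stretch a b t) * (1/2 + a) / (1/2 + b)"
    using assms by (simp add: stretch_alt)
  also have "\<dots> = 1/2 - ((1/2 - t) * (1/2 + b) / (1/2 + a)) * (1/2 + a) / (1/2 + b)"
    using False assms stretch_alt[of a t b] by simp
  also have "\<dots> = t"
  proof -
    have "(u * q / p) * p / q = u" if "0 < p" "0 < q" for u p q :: real
      using that by simp
    from this[of "1/2 + a" "1/2 + b" "1/2 - t"] show ?thesis
      using assms by linarith
  qed
  finally show ?thesis .
qed simp

lemma stretch_bounds:
  assumes "0 \<le> a" "0 \<le> b" "- a \<le> t" "t < 1"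
  shows "- b \<le> stretch a b t" "stretch a b t < 1"
proof -
  show "- b \<le> stretch a b t"
  proof (cases "t \<ge> 1/2")
    case False
    have "(1/2 - t) * (1/2 + b) / (1/2 + a) \<le> (1/2 + a) * (1/2 + b) / (1/2 + a)"
      using assms False by (intro divide_right_mono mult_right_mono) auto
    also have "\<dots> = 1/2 + b"
      using assms by simp
    finally show ?thesis
      using False assms by (simp add: stretch_alt)
  qed (use assms in simp)
  show "stretch a b t < 1"
    using assms stretch_le_half[of a b t] by (cases "t \<ge> 1/2") auto
qed

section \<open>Changing the height of the external collar inside one local collar\<close>

lemma topspace_collar_extension:
  "topspace (collar_extension M D f) =
     {(x, s). x \<in> topspace M \<and> (s = 0 \<or> x \<in> D \<and> 0 \<le> s \<and> s \<le> f x)}"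
  by (auto simp: collar_extension_def)

text \<open>The coordinates \<open>(\<rho> y, d y - s)\<close> turn the union of the local collar and the external collar
  over \<open>U\<close> into a product; the second coordinate is negative exactly on the external part.\<close>

definition collar_shift where
  "collar_shift B k \<rho> d a b = (\<lambda>(y, s). if y \<in> B
     then let t = stretch (a (\<rho> y)) (b (\<rho> y)) (d y - s) in (k (\<rho> y, max t 0), max (- t) 0)
     else (y, s))"

text \<open>The height is to change only over \<open>S\<close>. Closedness of \<open>S\<close>
  inside \<open>U\<close> keeps the points that move within a compact part of \<open>B\<close>, away
  from the edge of the local collar.\<close>

locale collar_step =
  fixes M :: "'a topology" and D U B k \<rho> d S
  assumes Haus: "Hausdorff_space M" and compact: "compact_space M"
    and closedD: "closedin M D"
    and lc: "local_collar M D U B k \<rho> d"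
    and closedS: "closedin M S" and SU: "S \<subseteq> U"
begin

lemma
  shows openB: "openin M B" and U_eq: "U = B \<inter> D"
    and cont_k: "continuous_map (prod_topology (subtopology M U) (top_of_set {0..<1})) (subtopology M B) k"
    and cont_\<rho>: "continuous_map (subtopology M B) (subtopology M U) \<rho>"
    and cont_d: "continuous_map (subtopology M B) (top_of_set {0..<1}) d"
    and k0: "\<And>x. x \<in> U \<Longrightarrow> k (x, 0) = x"
    and \<rho>k: "\<And>x t. x \<in> U \<Longrightarrow> 0 \<le> t \<Longrightarrow> t < 1 \<Longrightarrow> \<rho> (k (x, t)) = x"
    and dk: "\<And>x t. x \<in> U \<Longrightarrow> 0 \<le> t \<Longrightarrow> t < 1 \<Longrightarrow> d (k (x, t)) = t"
    and k\<rho>d: "\<And>y. y \<in> B \<Longrightarrow> k (\<rho> y, d y) = y"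
  using lc unfolding local_collar_def by auto

lemma B_sub: "B \<subseteq> topspace M"
  using openB openin_subset by blast

lemma \<rho>_in: "y \<in> B \<Longrightarrow> \<rho> y \<in> U"
  using continuous_map_in[OF cont_\<rho>] B_sub by auto

lemma d_bounds: "y \<in> B \<Longrightarrow> 0 \<le> d y" "y \<in> B \<Longrightarrow> d y < 1"
  using continuous_map_in[OF cont_d] B_sub by auto

lemma k_in: "x \<in> U \<Longrightarrow> 0 \<le> t \<Longrightarrow> t < 1 \<Longrightarrow> k (x, t) \<in> B"
  using continuous_map_in[OF cont_k] B_sub U_eq by auto

lemma \<rho>d_D:
  assumes "y \<in> B" "y \<in> D"
  shows "\<rho> y = y" "d y = 0"
  using assms U_eq k0[of y] \<rho>k[of y 0] dk[of y 0] by auto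

lemma collar_shift_outside:
  assumes y: "y \<in> topspace M" "s = 0 \<or> y \<in> D \<and> 0 \<le> s" "y \<notin> k ` (S \<times> {0..1/2})"
    and ab: "\<And>x. x \<in> D - S \<Longrightarrow> a x = b x"
  shows "collar_shift B k \<rho> d a b (y, s) = (y, s)"
proof (cases "y \<in> B")
  case True
  have s0: "d y = 0" "\<rho> y = y" if "s > 0"
    using \<rho>d_D True y that by auto
  have "\<rho> y \<notin> S \<or> d y > 1/2"
    using k\<rho>d[OF True] y(3) d_bounds[OF True] by (metis atLeastAtMost_iff image_eqI mem_Sigma_iff not_le)
  moreover have "\<rho> y \<in> D"
    using \<rho>_in[OF True] U_eq by auto
  ultimately have *: "stretch (a (\<rho> y)) (b (\<rho> y)) (d y - s) = d y - s"
    using ab s0 y(2) by (smt (verit, best) DiffI half_gt_zero_iff stretch_ge_half stretch_same)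
  show ?thesis
    using True y(2) s0 k\<rho>d[OF True] d_bounds[OF True] k0[of y] \<rho>d_D[of y] U_eq
    unfolding collar_shift_def prod.case Let_def *
    by (cases "s = 0") auto
qed (simp add: collar_shift_def)

text \<open>The coordinate \<open>d y - s\<close> is at least \<open>- a (\<rho> y)\<close>, since
  \<open>s > 0\<close> forces \<open>y\<close> into \<open>D\<close>, where \<open>d\<close>
  vanishes. Exchanging \<open>a\<close> and \<open>b\<close> inverts the stretch, and a signed
  coordinate is recovered from its positive and negative parts.\<close>

lemma collar_shift_in:
  assumes y: "(y, s) \<in> topspace (collar_extension M D a)"
    and ab: "\<And>x. x \<in> D - S \<Longrightarrow> a x = b x" "\<And>x. x \<in> D \<Longrightarrow> 0 \<le> a x" "\<And>x. x \<in> D \<Longrightarrow> 0 \<le> b x"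
  shows "collar_shift B k \<rho> d a b (y, s) \<in> topspace (collar_extension M D b)"
    and "collar_shift B k \<rho> d b a (collar_shift B k \<rho> d a b (y, s)) = (y, s)"
proof -
  have ys: "y \<in> topspace M" "s = 0 \<or> y \<in> D \<and> 0 \<le> s \<and> s \<le> a y"
    using y by (auto simp: topspace_collar_extension)
  have "collar_shift B k \<rho> d a b (y, s) \<in> topspace (collar_extension M D b) \<and>
    collar_shift B k \<rho> d b a (collar_shift B k \<rho> d a b (y, s)) = (y, s)" (is "?A \<and> ?B")
  proof (cases "y \<in> B")
    case False
    then have "y \<notin> S"
      using SU U_eq by auto
    then show ?thesis
      using False ys ab(1)[of y] by (auto simp: topspace_collar_extension collar_shift_def)
  next
    case yB: True
    define x where "x = \<rho> y"
    define t where "t = stretch (a x) (b x) (d y - s)"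
    have x: "x \<in> U" "x \<in> D" "x \<in> topspace M"
      using \<rho>_in[OF yB] U_eq B_sub by (auto simp: x_def)
    have rng: "- a x \<le> d y - s" "d y - s < 1"
      using ys d_bounds[OF yB] \<rho>d_D[OF yB] ab(2)[OF x(2)] by (auto simp: x_def)
    have t: "- b x \<le> t" "t < 1" "stretch (b x) (a x) t = d y - s"
      using stretch_bounds[OF ab(2,3)[OF x(2)] rng] stretch_inverse[OF ab(2,3)[OF x(2)]]
      by (auto simp: t_def)
    have eq: "collar_shift B k \<rho> d a b (y, s) = (k (x, max t 0), max (- t) 0)"
      using yB by (simp add: collar_shift_def x_def t_def Let_def)
    have kB: "k (x, max t 0) \<in> B"
      using k_in x t by auto
    have ?A
      unfolding eq using kB B_sub t x k0[of x] by (auto simp: topspace_collar_extension max_def)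
    have "\<rho> (k (x, max t 0)) = x" "d (k (x, max t 0)) = max t 0"
      using \<rho>k dk x t by auto
    then have "collar_shift B k \<rho> d b a (k (x, max t 0), max (- t) 0)
        = (let t' = stretch (b x) (a x) (max t 0 - max (- t) 0) in (k (x, max t' 0), max (- t') 0))"
      using kB by (simp add: collar_shift_def)
    also have "max t 0 - max (- t) 0 = t"
      by auto
    also have "(let t' = stretch (b x) (a x) t in (k (x, max t' 0), max (- t') 0))
        = (k (x, max (d y - s) 0), max (s - d y) 0)"
      unfolding Let_def t(3) by simp
    also have "\<dots> = (y, s)"
    proof (cases "s = 0")
      case True
      then show ?thesis
        using k\<rho>d[OF yB] d_bounds[OF yB] by (auto simp: x_def)
    next
      case False
      then show ?thesis
        using ys \<rho>d_D[OF yB] k0[of y] U_eq yB by (auto simp: x_def)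
    qed
    finally have ?B
      unfolding eq .
    with \<open>?A\<close> show ?thesis
      by simp
  qed
  then show "collar_shift B k \<rho> d a b (y, s) \<in> topspace (collar_extension M D b)"
    and "collar_shift B k \<rho> d b a (collar_shift B k \<rho> d a b (y, s)) = (y, s)"
    by auto
qed

text \<open>Two open sets suffice: over \<open>B\<close> the explicit formula is continuous, and off
  the closed set \<open>K\<close> inside \<open>B\<close> the map is the identity.\<close>

lemma continuous_collar_shift:
  assumes a: "continuous_map (subtopology M D) euclideanreal a"
    and b: "continuous_map (subtopology M D) euclideanreal b"
    and ab: "\<And>x. x \<in> D - S \<Longrightarrow> a x = b x" "\<And>x. x \<in> D \<Longrightarrow> 0 \<le> a x" "\<And>x. x \<in> D \<Longrightarrow> 0 \<le> b x"
  shows "continuous_map (collar_extension M D a) (collar_extension M D b) (collar_shift B k \<rho> d a b)"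
proof -
  let ?E = "collar_extension M D a" and ?T = "collar_shift B k \<rho> d a b"
  let ?P = "prod_topology M euclideanreal"
  define K where "K = k ` (S \<times> {0..1/2::real})"
  have cfst: "continuous_map ?E M fst" and csnd: "continuous_map ?E euclideanreal snd"
    unfolding collar_extension_def
    by (simp_all add: continuous_map_from_subtopology continuous_map_fst continuous_map_snd)
  \<comment> \<open>\<open>S\<close> is compact as a closed subset of a compact space, hence so is
    its image \<open>K\<close>, and compact sets in the Hausdorff space \<open>M\<close> are
    closed.\<close>
  have "compactin (prod_topology (subtopology M U) (top_of_set {0..<1})) (S \<times> {0..1/2::real})"
    using SU U_eq B_sub closedin_compact_space[OF compact closedS]
    by (auto simp: compactin_Times compactin_subtopology)
  then have "compactin (subtopology M B) K"
    unfolding K_def using cont_k image_compactin by blast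
  then have "closedin M K"
    using Haus by (simp add: compactin_subtopology compactin_imp_closedin)
  then have open2: "openin ?E {z \<in> topspace ?E. fst z \<in> topspace M - K}"
    by (intro openin_continuous_map_preimage[OF cfst] openin_diff) auto
  have open1: "openin ?E {z \<in> topspace ?E. fst z \<in> B}"
    by (intro openin_continuous_map_preimage[OF cfst] openB)
  have "K \<subseteq> B"
    using k_in SU by (force simp: K_def)
  have "continuous_map ?E ?P ?T"
  proof (rule continuous_map_open_cover2[OF open1 open2])
    show "topspace ?E \<subseteq> {z \<in> topspace ?E. fst z \<in> B} \<union> {z \<in> topspace ?E. fst z \<in> topspace M - K}"
      using \<open>K \<subseteq> B\<close> by (auto simp: topspace_collar_extension)
    have "continuous_map (subtopology ?E {z \<in> topspace ?E. fst z \<in> topspace M - K}) ?P id"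
      unfolding collar_extension_def
      by (simp add: continuous_map_from_subtopology)
    then show "continuous_map (subtopology ?E {z \<in> topspace ?E. fst z \<in> topspace M - K}) ?P ?T"
      by (rule continuous_map_eq)
         (use ab collar_shift_outside in \<open>auto simp: K_def topspace_collar_extension\<close>)
    let ?X = "subtopology ?E {z \<in> topspace ?E. fst z \<in> B}"
    have topX: "topspace ?X = {(y, s). y \<in> B \<and> (s = 0 \<or> y \<in> D \<and> 0 \<le> s \<and> s \<le> a y)}"
      using B_sub by (auto simp: topspace_collar_extension)
    have c1: "continuous_map ?X (subtopology M B) fst"
      using cfst by (auto simp: continuous_map_in_subtopology continuous_map_from_subtopology)
    have c\<rho>: "continuous_map ?X (subtopology M U) (\<lambda>z. \<rho> (fst z))"
      by (rule continuous_map_compose_app[OF cont_\<rho> c1])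
    have c\<rho>': "continuous_map ?X (subtopology M D) (\<lambda>z. \<rho> (fst z))"
      using c\<rho> U_eq by (auto simp: continuous_map_in_subtopology)
    have cd: "continuous_map ?X euclideanreal (\<lambda>z. d (fst z))"
      using continuous_map_compose_app[OF cont_d c1] by (simp add: continuous_map_in_subtopology)
    have cs: "continuous_map ?X euclideanreal snd"
      by (rule continuous_map_from_subtopology[OF csnd])
    have ca: "continuous_map ?X euclideanreal (\<lambda>z. a (\<rho> (fst z)))"
      and cb: "continuous_map ?X euclideanreal (\<lambda>z. b (\<rho> (fst z)))"
      using continuous_map_compose_app[OF a c\<rho>'] continuous_map_compose_app[OF b c\<rho>'] by auto
    define \<tau> where "\<tau> z = stretch (a (\<rho> (fst z))) (b (\<rho> (fst z))) (d (fst z) - snd z)" for z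
    have apos: "0 \<le> a (\<rho> (fst z))" if "z \<in> topspace ?X" for z
      using that ab \<rho>_in U_eq topX by fastforce
    have c\<tau>: "continuous_map ?X euclideanreal \<tau>"
      unfolding \<tau>_def stretch_def
      by (intro continuous_map_diff continuous_map_real_mult continuous_map_real_divide
            continuous_map_real_max continuous_map_add cd cs ca cb continuous_map_const[THEN iffD2])
         (use apos in force)+
    have rng: "\<tau> z < 1" if z: "z \<in> topspace ?X" for z
    proof -
      obtain y s where ys: "z = (y, s)" "y \<in> B" "s = 0 \<or> y \<in> D \<and> 0 \<le> s \<and> s \<le> a y"
        using z[unfolded topX] by auto
      have D: "\<rho> y \<in> D" using \<rho>_in[OF ys(2)] U_eq by auto
      show ?thesis unfolding \<tau>_def ys fst_conv snd_conv
        by (rule stretch_bounds(2)) (use ys ab(2,3)[OF D] d_bounds[OF ys(2)] \<rho>d_D[OF ys(2)] in auto)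
    qed
    have "continuous_map ?X (subtopology M B) (\<lambda>z. k (\<rho> (fst z), max (\<tau> z) 0))"
      by (intro continuous_map_compose_pair[OF cont_k] c\<rho>)
         (auto simp: continuous_map_in_subtopology intro!: continuous_map_real_max c\<tau> rng)
    then have "continuous_map ?X ?P (\<lambda>z. (k (\<rho> (fst z), max (\<tau> z) 0), max (- \<tau> z) 0))"
      by (auto simp: continuous_map_paired continuous_map_in_subtopology
            intro!: continuous_map_real_max continuous_map_minus c\<tau>)
    then show "continuous_map ?X ?P ?T"
      by (rule continuous_map_eq) (auto simp: topX collar_shift_def \<tau>_def Let_def)
  qed
  moreover have "?T \<in> topspace ?E \<rightarrow> topspace (collar_extension M D b)"
  proof
    show "?T z \<in> topspace (collar_extension M D b)" if "z \<in> topspace ?E" for z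
      using collar_shift_in(1)[OF _ ab, of "fst z" "snd z"] that by simp
  qed
  then have "?T \<in> topspace ?E \<rightarrow> {(x, s). s = 0 \<or> x \<in> D \<and> 0 \<le> s \<and> s \<le> b x}"
    unfolding topspace_collar_extension[of M D b] Pi_iff by auto
  ultimately show ?thesis
    unfolding collar_extension_def[of M D b] continuous_map_in_subtopology by blast
qed

text \<open>The stretch takes the lower end \<open>- a\<close> to the lower end \<open>- b\<close>,
  so the outer end of each fibre goes to the new outer end of the same fibre.\<close>

lemma collared_shift:
  assumes a: "continuous_map (subtopology M D) euclideanreal a"
    and b: "continuous_map (subtopology M D) euclideanreal b"
    and ab: "\<And>x. x \<in> D - S \<Longrightarrow> a x = b x" "\<And>x. x \<in> D \<Longrightarrow> 0 \<le> a x" "\<And>x. x \<in> D \<Longrightarrow> 0 \<le> b x"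
    and "collared M D a"
  shows "collared M D b"
proof -
  let ?T = "collar_shift B k \<rho> d a b"
  obtain G where G: "homeomorphic_map M (collar_extension M D a) G" "\<forall>x\<in>D. G x = (x, a x)"
    using assms unfolding collared_def by auto
  have ba: "\<And>x. x \<in> D - S \<Longrightarrow> b x = a x" using ab by auto
  have "homeomorphic_maps (collar_extension M D a) (collar_extension M D b) ?T (collar_shift B k \<rho> d b a)"
    unfolding homeomorphic_maps_def
    using continuous_collar_shift[OF a b ab] continuous_collar_shift[OF b a ba ab(3,2)]
      collar_shift_in(2)[OF _ ab] collar_shift_in(2)[OF _ ba ab(3,2)] by fastforce
  then have "homeomorphic_map M (collar_extension M D b) (?T \<circ> G)"
    using G homeomorphic_map_compose homeomorphic_maps_map by blast
  moreover have "(?T \<circ> G) x = (x, b x)" if x: "x \<in> D" for x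
  proof (cases "x \<in> B")
    case True
    then show ?thesis
      using \<rho>d_D[OF True x] G(2) x ab k0[of x] U_eq by (auto simp: collar_shift_def)
  next
    case False
    then show ?thesis
      using G(2) x ab(1)[of x] SU U_eq by (auto simp: collar_shift_def)
  qed
  ultimately show ?thesis
    unfolding collared_def by blast
qed

end

section \<open>From local collars to a global collar\<close>

lemma collared_cong:
  assumes "\<And>x. x \<in> D \<Longrightarrow> f x = g x" "collared M D f"
  shows "collared M D g"
proof -
  have "{(x, s). s = 0 \<or> x \<in> D \<and> 0 \<le> s \<and> s \<le> f x} = {(x, s). s = 0 \<or> x \<in> D \<and> 0 \<le> s \<and> s \<le> g x}"
    using assms(1) by auto
  then show ?thesis
    using assms unfolding collared_def collar_extension_def by auto
qed

lemma collared_zero: "collared M D (\<lambda>_. 0)"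
proof -
  have "homeomorphic_maps M (collar_extension M D (\<lambda>_. 0)) (\<lambda>x. (x, 0)) fst"
    unfolding homeomorphic_maps_def collar_extension_def
    by (auto simp: continuous_map_in_subtopology continuous_map_paired
        intro: continuous_map_from_subtopology continuous_map_fst)
  then show ?thesis
    unfolding collared_def homeomorphic_map_maps by blast
qed

text \<open>Urysohn's lemma applies in \<open>D\<close>, which is compact Hausdorff and hence
  normal.\<close>

lemma local_collar_bump:
  assumes "Hausdorff_space M" "compact_space M" "closedin M D" "local_collar M D U B k \<rho> d" "p \<in> U"
  obtains f S where "continuous_map (subtopology M D) euclideanreal f" "closedin M S" "S \<subseteq> U"
    "0 < f p" "\<And>x. 0 \<le> f x" "\<And>x. x \<in> D - S \<Longrightarrow> f x = 0"
proof -
  let ?X = "subtopology M D"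
  have U: "openin ?X U" "U \<subseteq> D"
    using assms(4) by (auto simp: local_collar_def openin_subtopology)
  have topX: "topspace ?X = D"
    using assms(3) closedin_subset by fastforce
  have "compact_space ?X"
    by (simp add: assms closedin_compact_space compact_space_subtopology)
  then have "normal_space ?X"
    by (simp add: assms(1) Hausdorff_space_subtopology compact_Hausdorff_or_regular_imp_normal_space)
  moreover have "closedin ?X {p}"
    using assms(1,5) U topX by (simp add: Hausdorff_space_subtopology closedin_Hausdorff_singleton subset_iff)
  moreover have "closedin ?X (D - U)"
    using U topX by (metis closedin_def double_diff Diff_subset order_refl)
  moreover have "disjnt (D - U) {p}"
    using assms(5) by auto
  ultimately obtain g where g: "continuous_map ?X (top_of_set {0..1::real}) g"
      "g ` (D - U) \<subseteq> {0}" "g ` {p} \<subseteq> {1}"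
    by (metis Urysohn_lemma zero_le_one)
  have cg: "continuous_map ?X euclideanreal g"
    using g(1) by (simp add: continuous_map_in_subtopology)
  \<comment> \<open>The set where \<open>g\<close> is positive need not lie in a closed subset of
    \<open>U\<close>. Truncating \<open>g\<close> at 1/2 confines the bump to the closed set
    \<open>g \<ge> 1/2\<close>, which avoids \<open>D - U\<close>.\<close>
  define S where "S = {x \<in> topspace ?X. g x \<in> {1/2..}}"
  have "closedin ?X S"
    unfolding S_def by (rule closedin_continuous_map_preimage[OF cg]) auto
  then have "closedin M S"
    using assms(3) closedin_closed_subtopology by blast
  show thesis
  proof (rule that[of "\<lambda>x. max 0 (g x - 1/2)" S])
    show "continuous_map ?X euclideanreal (\<lambda>x. max 0 (g x - 1/2))"
      by (intro continuous_map_real_max continuous_map_diff cg) auto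
    show "S \<subseteq> U"
      using g(2) topX by (force simp: S_def)
    show "closedin M S" by fact
  qed (use g(3) topX in \<open>auto simp: S_def\<close>)
qed

text \<open>Finitely many bumps, divided by their sum, form a partition of unity on
  \<open>D\<close>. Their partial sums are heights leading from 0 to 1, and consecutive heights
  differ only inside one local collar.\<close>

theorem collared_one:
  assumes M: "Hausdorff_space M" "compact_space M" and D: "closedin M D"
    and lc: "\<And>p. p \<in> D \<Longrightarrow> \<exists>U B k \<rho> d. local_collar M D U B k \<rho> d \<and> p \<in> U"
  shows "collared M D (\<lambda>_. 1)"
proof -
  let ?X = "subtopology M D"
  have topX: "topspace ?X = D"
    using D closedin_subset by fastforce
  define good where "good f \<longleftrightarrow> continuous_map ?X euclideanreal f \<and> (\<forall>x. 0 \<le> f x) \<and>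
    (\<exists>U B k \<rho> d S. collar_step M D U B k \<rho> d S \<and> (\<forall>x \<in> D - S. f x = 0))" for f
  have "\<exists>f. good f \<and> 0 < f p" if p: "p \<in> D" for p
  proof -
    obtain U B k \<rho> d where l: "local_collar M D U B k \<rho> d" "p \<in> U"
      using lc[OF p] by blast
    obtain f S where f: "continuous_map ?X euclideanreal f" "closedin M S" "S \<subseteq> U"
        "0 < f p" "\<And>x. 0 \<le> f x" "\<And>x. x \<in> D - S \<Longrightarrow> f x = 0"
      using local_collar_bump[OF M D l] by metis
    have "collar_step M D U B k \<rho> d S"
      using M D l(1) f(2,3) by (intro collar_step.intro)
    with f(6) have "\<exists>U B k \<rho> d S. collar_step M D U B k \<rho> d S \<and> (\<forall>x \<in> D - S. f x = 0)"
      by (intro exI conjI ballI)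
    then have "good f"
      using f(1,5) by (simp add: good_def)
    then show ?thesis
      using f(4) by blast
  qed
  then have "\<forall>p\<in>D. \<exists>f. good f \<and> 0 < f p"
    by simp
  from bchoice[OF this] obtain \<Lambda>
    where \<Lambda>: "\<And>p. p \<in> D \<Longrightarrow> good (\<Lambda> p)" "\<And>p. p \<in> D \<Longrightarrow> 0 < \<Lambda> p p"
    by blast
  have \<Lambda>c: "continuous_map ?X euclideanreal (\<Lambda> p)" and \<Lambda>0: "0 \<le> \<Lambda> p x" if "p \<in> D" for p x
    using \<Lambda>(1)[OF that] unfolding good_def by auto
  define V where "V p = {x \<in> topspace ?X. \<Lambda> p x \<in> {0<..}}" for p
  have "openin ?X (V p)" if "p \<in> D" for p
    unfolding V_def using \<Lambda>c[OF that] by (rule openin_continuous_map_preimage) auto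
  moreover have "topspace ?X \<subseteq> \<Union> (V ` D)"
    using \<Lambda>(2) topX by (auto simp: V_def)
  moreover have "compact_space ?X"
    by (simp add: M D closedin_compact_space compact_space_subtopology)
  ultimately obtain \<F> where \<F>: "finite \<F>" "\<F> \<subseteq> V ` D" "topspace ?X \<subseteq> \<Union> \<F>"
    unfolding compact_space_alt by (metis (mono_tags, lifting) imageE)
  then obtain F where F: "finite F" "F \<subseteq> D" "D \<subseteq> \<Union> (V ` F)"
    by (metis finite_subset_image topX)
  define f where "f x = (\<Sum>p\<in>F. \<Lambda> p x)" for x
  have fpos: "0 < f x" if x: "x \<in> D" for x
  proof -
    obtain p where "p \<in> F" "\<Lambda> p x > 0"
      using F x by (auto simp: V_def)
    then show ?thesis
      unfolding f_def using F \<Lambda>0 by (intro sum_pos2[of F p]) auto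
  qed
  have cf: "continuous_map ?X euclideanreal f"
    unfolding f_def using F \<Lambda>c by (intro continuous_map_sum) auto
  have c\<mu>: "continuous_map ?X euclideanreal (\<lambda>x. \<Lambda> p x / f x)" if "p \<in> F" for p
  proof (rule continuous_map_real_divide[OF \<Lambda>c cf])
    show "p \<in> D"
      using that F by auto
    show "f x \<noteq> 0" if "x \<in> topspace ?X" for x
      using fpos that topX by force
  qed
  \<comment> \<open>Induction over subsets of \<open>F\<close> adds one bump at a time; the
    denominator \<open>f\<close> stays the full sum throughout.\<close>
  have "collared M D (\<lambda>x. \<Sum>p\<in>A. \<Lambda> p x / f x)" if "finite A" "A \<subseteq> F" for A
    using that
  proof (induction A rule: finite_induct)
    case empty
    then show ?case
      by (simp add: collared_zero)
  next
    case (insert p A)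
    have p: "good (\<Lambda> p)" "p \<in> F"
      using insert F \<Lambda> by auto
    then obtain U B k \<rho> d S where step: "collar_step M D U B k \<rho> d S" and S: "\<forall>x \<in> D - S. \<Lambda> p x = 0"
      unfolding good_def by metis
    have nonneg: "0 \<le> \<Lambda> q x / f x" if "q \<in> F" "x \<in> D" for q x
      using that F \<Lambda>0[of q x] fpos[of x] by auto
    show ?case
    proof (rule collar_step.collared_shift[OF step])
      show "collared M D (\<lambda>x. \<Sum>p\<in>A. \<Lambda> p x / f x)"
        using insert by auto
      show "continuous_map ?X euclideanreal (\<lambda>x. \<Sum>p\<in>A. \<Lambda> p x / f x)"
        "continuous_map ?X euclideanreal (\<lambda>x. \<Sum>p\<in>insert p A. \<Lambda> p x / f x)"
        using insert.hyps insert.prems by (intro continuous_map_sum c\<mu>; blast)+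
    qed (use insert S nonneg in \<open>auto intro!: sum_nonneg add_nonneg_nonneg\<close>)
  qed
  from this[OF F(1) order_refl] show ?thesis
  proof (rule collared_cong[rotated])
    show "(\<Sum>p\<in>F. \<Lambda> p x / f x) = 1" if "x \<in> D" for x
      using fpos[OF that] by (simp add: f_def flip: sum_divide_distrib)
  qed
qed

section \<open>Germs of spaces and the boundary of a manifold\<close>

text \<open>A pointed local homeomorphism, giving an equivalence relation between points of
  different spaces. Charts can then be composed and multiplied without carrying their domains
  along.\<close>

definition germ_homeomorphic :: "'a topology \<Rightarrow> 'a \<Rightarrow> 'b topology \<Rightarrow> 'b \<Rightarrow> bool" where
  "germ_homeomorphic X p Y q \<longleftrightarrow>
     (\<exists>U V f g. openin X U \<and> p \<in> U \<and> openin Y V \<and>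
        homeomorphic_maps (subtopology X U) (subtopology Y V) f g \<and> f p = q)"

lemma homeomorphic_mapsD:
  assumes "homeomorphic_maps X Y f g"
  shows "continuous_map X Y f" "continuous_map Y X g"
    "\<And>x. x \<in> topspace X \<Longrightarrow> f x \<in> topspace Y" "\<And>y. y \<in> topspace Y \<Longrightarrow> g y \<in> topspace X"
    "\<And>x. x \<in> topspace X \<Longrightarrow> g (f x) = x" "\<And>y. y \<in> topspace Y \<Longrightarrow> f (g y) = y"
  using assms continuous_map_in[of X Y f] continuous_map_in[of Y X g]
  by (simp_all add: homeomorphic_maps_def)

lemma homeomorphic_maps_preimage_open:
  assumes "homeomorphic_maps X Y f g" "openin Y N"
  shows "openin X {x \<in> topspace X. f x \<in> N}"
    and "homeomorphic_maps (subtopology X {x \<in> topspace X. f x \<in> N}) (subtopology Y N) f g"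
proof -
  show "openin X {x \<in> topspace X. f x \<in> N}"
    by (rule openin_continuous_map_preimage[OF homeomorphic_mapsD(1)[OF assms(1)] assms(2)])
  show "homeomorphic_maps (subtopology X {x \<in> topspace X. f x \<in> N}) (subtopology Y N) f g"
    by (rule homeomorphic_maps_subtopologies_alt[OF assms(1)]) (use homeomorphic_mapsD[OF assms(1)] in auto)
qed

lemma germ_homeomorphicI:
  assumes "openin X U" "p \<in> U" "openin Y V"
    and "homeomorphic_maps (subtopology X U) (subtopology Y V) f g" "f p = q"
  shows "germ_homeomorphic X p Y q"
  using assms unfolding germ_homeomorphic_def by blast

lemma germ_homeomorphicE:
  assumes "germ_homeomorphic X p Y q"
  obtains U V f g where "openin X U" "p \<in> U" "openin Y V" "q \<in> V"
    "homeomorphic_maps (subtopology X U) (subtopology Y V) f g" "f p = q" "g q = p"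
proof -
  obtain U V f g where *: "openin X U" "p \<in> U" "openin Y V"
    "homeomorphic_maps (subtopology X U) (subtopology Y V) f g" "f p = q"
    using assms unfolding germ_homeomorphic_def by blast
  have "p \<in> topspace (subtopology X U)"
    using *(1,2) openin_subset by fastforce
  then have "f p \<in> topspace (subtopology Y V)" "g (f p) = p"
    using homeomorphic_mapsD[OF *(4)] by blast+
  then show thesis
    using * that[of U V f g] by simp
qed

lemma germ_homeomorphic_sym:
  assumes "germ_homeomorphic X p Y q"
  shows "germ_homeomorphic Y q X p"
  using assms by (elim germ_homeomorphicE) (metis germ_homeomorphicI homeomorphic_maps_sym)

text \<open>Both charts around \<open>q\<close> are cut down to the common open set
  \<open>N\<close>; its preimage in \<open>X\<close> and its image in \<open>Z\<close> carry the
  composite.\<close>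

lemma germ_homeomorphic_trans:
  assumes "germ_homeomorphic X p Y q" "germ_homeomorphic Y q Z r"
  shows "germ_homeomorphic X p Z r"
proof -
  obtain U V f g where 1: "openin X U" "p \<in> U" "openin Y V" "q \<in> V"
    "homeomorphic_maps (subtopology X U) (subtopology Y V) f g" "f p = q"
    using assms(1) by (rule germ_homeomorphicE)
  obtain U' V' f' g' where 2: "openin Y U'" "q \<in> U'" "openin Z V'"
    "homeomorphic_maps (subtopology Y U') (subtopology Z V') f' g'" "f' q = r"
    using assms(2) by (rule germ_homeomorphicE)
  define N where "N = V \<inter> U'"
  have N: "openin Y N" "openin (subtopology Y V) N" "openin (subtopology Y U') N"
    using 1 2 by (auto simp: N_def openin_open_subtopology)
  define S where "S = {x \<in> topspace (subtopology X U). f x \<in> N}"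
  have S: "openin (subtopology X U) S" "homeomorphic_maps (subtopology (subtopology X U) S) (subtopology (subtopology Y V) N) f g"
    unfolding S_def using homeomorphic_maps_preimage_open[OF 1(5) N(2)] by auto
  define T where "T = {z \<in> topspace (subtopology Z V'). g' z \<in> N}"
  have T: "openin (subtopology Z V') T" "homeomorphic_maps (subtopology (subtopology Z V') T) (subtopology (subtopology Y U') N) g' f'"
    unfolding T_def using homeomorphic_maps_preimage_open[OF _ N(3)] 2(4) homeomorphic_maps_sym by blast+
  have "homeomorphic_maps (subtopology X S) (subtopology Y N) f g"
    using S(2) by (simp add: subtopology_subtopology S_def N_def Int_absorb1 Int_absorb2 inf.absorb2 subset_iff
        Collect_conj_eq Int_assoc Int_left_absorb)
  moreover have "homeomorphic_maps (subtopology Y N) (subtopology Z T) f' g'"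
    using T(2) homeomorphic_maps_sym
    by (metis N_def T(1) inf.absorb2 inf_le2 openin_imp_subset subtopology_subtopology)
  ultimately have "homeomorphic_maps (subtopology X S) (subtopology Z T) (f' \<circ> f) (g \<circ> g')"
    using homeomorphic_maps_compose by blast
  moreover have "openin X S" "openin Z T"
    using S(1) T(1) 1(1) 2(3) openin_trans_full by blast+
  moreover have "p \<in> S"
    using 1 2(2) openin_subset by (fastforce simp: S_def N_def)
  ultimately show ?thesis
    using 1(6) 2(5) by (intro germ_homeomorphicI[of X S p Z T "f' \<circ> f"]) auto
qed

lemma germ_homeomorphic_open_embedding:
  assumes "homeomorphic_maps X (subtopology Y V) f g" "openin Y V" "p \<in> topspace X"
  shows "germ_homeomorphic X p Y (f p)"
  using assms by (intro germ_homeomorphicI[of X "topspace X" p Y V f g]) auto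

lemma germ_homeomorphic_open_subtopology:
  assumes "openin X U" "p \<in> U"
  shows "germ_homeomorphic (subtopology X U) p X p"
  using germ_homeomorphic_open_embedding[of "subtopology X U" X U id id p] assms openin_subset[OF assms(1)]
  by (auto simp: homeomorphic_maps_id)

lemma germ_homeomorphic_topspace:
  assumes "germ_homeomorphic X p Y q"
  shows "p \<in> topspace X" "q \<in> topspace Y"
  using assms by (auto elim!: germ_homeomorphicE dest: openin_subset)

lemma germ_homeomorphic_prod:
  assumes "germ_homeomorphic X p X' p'" "germ_homeomorphic Y q Y' q'"
  shows "germ_homeomorphic (prod_topology X Y) (p, q) (prod_topology X' Y') (p', q')"
proof -
  obtain U V f g where 1: "openin X U" "p \<in> U" "openin X' V"
    "homeomorphic_maps (subtopology X U) (subtopology X' V) f g" "f p = p'"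
    using assms(1) by (rule germ_homeomorphicE)
  obtain S T h k where 2: "openin Y S" "q \<in> S" "openin Y' T"
    "homeomorphic_maps (subtopology Y S) (subtopology Y' T) h k" "h q = q'"
    using assms(2) by (rule germ_homeomorphicE)
  have "homeomorphic_maps (prod_topology (subtopology X U) (subtopology Y S))
      (prod_topology (subtopology X' V) (subtopology Y' T))
      (\<lambda>(x, y). (f x, h y)) (\<lambda>(x, y). (g x, k y))"
    using 1(4) 2(4) by (simp add: homeomorphic_maps_prod)
  then show ?thesis
    using 1 2 by (intro germ_homeomorphicI[of _ "U \<times> S" _ _ "V \<times> T" "\<lambda>(x, y). (f x, h y)"])
      (auto simp: subtopology_Times openin_prod_Times_iff)
qed

lemma germ_homeomorphic_refl: "p \<in> topspace X \<Longrightarrow> germ_homeomorphic X p X p"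
  using germ_homeomorphic_open_subtopology[of X "topspace X" p] by simp

section \<open>Interior and manifold points in terms of germs\<close>

lemma manifold_interior_iff_germ:
  "p \<in> manifold_interior n M \<longleftrightarrow> (\<exists>q. germ_homeomorphic M p (Euclidean_space n) q)"
  unfolding manifold_interior_def germ_homeomorphic_def homeomorphic_space_def
  using openin_subset by fast

lemma topological_manifold_iff_germ:
  "topological_manifold n M \<longleftrightarrow> Hausdorff_space M \<and> second_countable M \<and>
     (\<forall>p \<in> topspace M. \<exists>q. germ_homeomorphic M p (Euclidean_half_space n) q)"
  unfolding topological_manifold_def germ_homeomorphic_def homeomorphic_space_def by blast

lemma openin_manifold_interior: "openin M (manifold_interior n M)"
proof (subst openin_subopen, intro ballI)
  fix p assume "p \<in> manifold_interior n M"
  then obtain U V where "openin M U" "p \<in> U" "openin (Euclidean_space n) V"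
      "subtopology M U homeomorphic_space subtopology (Euclidean_space n) V"
    by (auto simp: manifold_interior_def)
  then show "\<exists>T. openin M T \<and> p \<in> T \<and> T \<subseteq> manifold_interior n M"
    using openin_subset by (intro exI[of _ U]) (force simp: manifold_interior_def)
qed

lemma closedin_manifold_boundary: "closedin M (manifold_boundary n M)"
  unfolding manifold_boundary_def by (simp add: openin_manifold_interior closedin_diff)

section \<open>Charts in Euclidean spaces and half-spaces\<close>

lemma topspace_Euclidean_half_space:
  "topspace (Euclidean_half_space n) = {x. 0 \<le> x 0 \<and> (\<forall>i\<ge>n. x i = 0)}"
  by (auto simp: Euclidean_half_space_def topspace_Euclidean_space)

lemma continuous_map_Euclidean_space_componentwise:
  "continuous_map X (Euclidean_space n) f \<longleftrightarrow>
     (\<forall>i. continuous_map X euclideanreal (\<lambda>x. f x i)) \<and> (\<forall>x \<in> topspace X. \<forall>i\<ge>n. f x i = 0)"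
  unfolding Euclidean_space_def continuous_map_in_subtopology continuous_map_componentwise_UNIV
  by auto

lemma continuous_map_Euclidean_half_space_componentwise:
  "continuous_map X (Euclidean_half_space n) f \<longleftrightarrow>
     (\<forall>i. continuous_map X euclideanreal (\<lambda>x. f x i)) \<and>
     (\<forall>x \<in> topspace X. 0 \<le> f x 0 \<and> (\<forall>i\<ge>n. f x i = 0))"
  unfolding Euclidean_half_space_def continuous_map_in_subtopology
    continuous_map_Euclidean_space_componentwise by auto

lemma continuous_map_Euclidean_space_component:
  "continuous_map (Euclidean_space n) euclideanreal (\<lambda>x. x i)"
  "continuous_map (Euclidean_half_space n) euclideanreal (\<lambda>x. x i)"
  unfolding Euclidean_half_space_def Euclidean_space_def
  by (rule continuous_map_from_subtopology continuous_map_product_projection UNIV_I)+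

text \<open>By invariance of domain, a Euclidean chart would make a neighbourhood of
  \<open>q\<close> in the half-space open in the whole Euclidean space, yet a small step in the
  negative direction of coordinate 0 leaves the half-space.\<close>

lemma Euclidean_half_space_boundary_germ:
  assumes n: "n \<ge> 1" and q: "q 0 = 0"
  shows "\<not> germ_homeomorphic (Euclidean_half_space n) q (Euclidean_space n) z"
proof
  assume "germ_homeomorphic (Euclidean_half_space n) q (Euclidean_space n) z"
  then obtain V U f g where *: "openin (Euclidean_half_space n) V" "q \<in> V" "openin (Euclidean_space n) U"
    and hm: "homeomorphic_maps (subtopology (Euclidean_half_space n) V) (subtopology (Euclidean_space n) U) f g"
    by (rule germ_homeomorphicE)
  have topU: "topspace (subtopology (Euclidean_space n) U) = U"
    and topV: "topspace (subtopology (Euclidean_half_space n) V) = V"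
    using *(1,3) openin_subset by fastforce+
  have "continuous_map (subtopology (Euclidean_space n) U) (Euclidean_space n) g"
    using hm by (simp add: homeomorphic_maps_def continuous_map_in_subtopology Euclidean_half_space_def)
  moreover have "homeomorphic_map (subtopology (Euclidean_space n) U) (subtopology (Euclidean_half_space n) V) g"
    using hm homeomorphic_maps_map by blast
  then have "inj_on g U" and gU: "g ` U = V"
    using homeomorphic_imp_injective_map homeomorphic_imp_surjective_map topU topV by metis+
  ultimately have "openin (Euclidean_space n) V"
    using *(3) invariance_of_domain_Euclidean_space by metis
  \<comment> \<open>The line through \<open>q\<close> along coordinate 0; \<open>n \<ge> 1\<close>
    keeps it inside \<open>Euclidean_space n\<close>.\<close>
  moreover have "continuous_map euclideanreal (Euclidean_space n) (\<lambda>t. q(0 := t))"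
    unfolding continuous_map_Euclidean_space_componentwise
  proof (intro conjI allI ballI impI)
    show "continuous_map euclideanreal euclideanreal (\<lambda>t. (q(0 := t)) i)" for i
      by (cases "i = 0") auto
    show "(q(0 := t)) i = 0" if "n \<le> i" for t i
      using that n *(1,2) openin_subset[OF *(1)] by (auto simp: topspace_Euclidean_half_space)
  qed
  ultimately have "openin euclideanreal {t \<in> topspace euclideanreal. q(0 := t) \<in> V}"
    by (intro openin_continuous_map_preimage)
  then have "open {t. q(0 := t) \<in> V}"
    by simp
  moreover have "0 \<in> {t. q(0 := t) \<in> V}"
    using q *(2) by (simp add: fun_upd_idem)
  ultimately obtain e where "e > 0" "\<And>t. \<bar>t\<bar> < e \<Longrightarrow> q(0 := t) \<in> V"
    unfolding open_dist dist_real_def by force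
  then have "q(0 := - e / 2) \<in> V"
    by auto
  then show False
    using openin_subset[OF *(1)] \<open>e > 0\<close> by (force simp: topspace_Euclidean_half_space)
qed

text \<open>The region \<open>x 0 > 0\<close> is open in both spaces and inherits the same topology
  from them.\<close>

lemma Euclidean_half_space_interior_germ:
  assumes "q \<in> topspace (Euclidean_half_space n)" "q 0 > 0"
  shows "germ_homeomorphic (Euclidean_half_space n) q (Euclidean_space n) q"
proof -
  have "{x \<in> topspace (Euclidean_space n). x 0 \<in> {0<..}} = {x \<in> topspace (Euclidean_half_space n). x 0 > 0}"
    by (auto simp: topspace_Euclidean_half_space topspace_Euclidean_space)
  moreover have "openin (Euclidean_space n) {x \<in> topspace (Euclidean_space n). x 0 \<in> {0<..}}"
    by (rule openin_continuous_map_preimage[OF continuous_map_Euclidean_space_component(1)]) auto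
  ultimately have o: "openin (Euclidean_space n) {x \<in> topspace (Euclidean_half_space n). x 0 > 0}" (is "openin _ ?S")
    by simp
  then have o': "openin (Euclidean_half_space n) ?S"
    unfolding Euclidean_half_space_def by (intro subset_openin_subtopology) auto
  have "subtopology (Euclidean_half_space n) ?S = subtopology (Euclidean_space n) ?S"
    unfolding Euclidean_half_space_def subtopology_subtopology by (rule arg_cong[of _ _ "subtopology _"]) auto
  then show ?thesis
    using germ_homeomorphic_open_subtopology[OF o, of q] germ_homeomorphic_open_subtopology[OF o', of q] assms
      germ_homeomorphic_sym germ_homeomorphic_trans
    by (metis (mono_tags, lifting) mem_Collect_eq)
qed

text \<open>Applying \<open>exp\<close> to coordinate 0 maps the whole space onto the open
  half-space \<open>x 0 > 0\<close>. For this coordinate 0 must be a genuine one, whence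
  \<open>n \<ge> 1\<close>.\<close>

lemma Euclidean_space_germ_half_space:
  assumes n: "n \<ge> 1" and "q \<in> topspace (Euclidean_space n)"
  shows "\<exists>r. germ_homeomorphic (Euclidean_space n) q (Euclidean_half_space n) r"
proof -
  let ?f = "\<lambda>x::nat \<Rightarrow> real. x(0 := exp (x 0))" and ?g = "\<lambda>x::nat \<Rightarrow> real. x(0 := ln (x 0))"
  let ?H = "subtopology (Euclidean_half_space n) {x \<in> topspace (Euclidean_half_space n). x 0 \<in> {0<..}}"
  have 1: "continuous_map (Euclidean_space n) euclideanreal (\<lambda>x. ?f x i)" for i
    using continuous_map_compose_app[OF _ continuous_map_Euclidean_space_component(1)[of n 0],
        of euclideanreal exp] continuous_map_Euclidean_space_component(1)[of n i]
    by (cases "i = 0") (auto simp: continuous_on_exp)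
  have "continuous_map ?H (top_of_set {0<..}) (\<lambda>x. x 0)"
    by (auto simp: continuous_map_in_subtopology continuous_map_from_subtopology
        continuous_map_Euclidean_space_component)
  then have 2: "continuous_map ?H euclideanreal (\<lambda>x. ln (x 0))"
    by (rule continuous_map_compose_app[rotated]) (auto intro!: continuous_on_ln)
  have 3: "continuous_map ?H euclideanreal (\<lambda>x. ?g x i)" for i
    using 2 continuous_map_Euclidean_space_component(2)[of n i]
    by (cases "i = 0") (auto simp: continuous_map_from_subtopology)
  have "homeomorphic_maps (Euclidean_space n) ?H ?f ?g"
    unfolding homeomorphic_maps_def
    using 1 3 n by (auto simp: continuous_map_in_subtopology continuous_map_Euclidean_space_componentwise
        continuous_map_Euclidean_half_space_componentwise topspace_Euclidean_space topspace_Euclidean_half_space)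
  moreover have "openin (Euclidean_half_space n) {x \<in> topspace (Euclidean_half_space n). x 0 \<in> {0<..}}"
    by (rule openin_continuous_map_preimage[OF continuous_map_Euclidean_space_component(2)]) auto
  ultimately show ?thesis
    using germ_homeomorphic_open_embedding[of _ _ _ ?f ?g q] assms(2) by blast
qed

text \<open>The half-space constrains coordinate 0, so the collar parameter is prepended and the
  other coordinates move up by one.\<close>

lemma germ_half_space_product:
  fixes z :: "nat \<Rightarrow> real" and t :: real
  assumes "z \<in> topspace (Euclidean_space m)" "t \<ge> 0"
  shows "germ_homeomorphic (prod_topology (Euclidean_space m) (top_of_set {0..})) (z, t)
           (Euclidean_half_space (Suc m)) (case_nat t z)"
proof -
  let ?P = "prod_topology (Euclidean_space m) (top_of_set {0::real..})"
  let ?f = "\<lambda>x::(nat \<Rightarrow> real) \<times> real. case_nat (snd x) (fst x)"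
  let ?g = "\<lambda>x::nat \<Rightarrow> real. (\<lambda>i. x (Suc i), x 0)"
  have 1: "continuous_map ?P euclideanreal (\<lambda>x. ?f x i)" for i
  proof (cases i)
    case 0
    then show ?thesis
      using continuous_map_snd[of "Euclidean_space m" "top_of_set {0::real..}"]
      by (simp add: continuous_map_in_subtopology)
  next
    case (Suc j)
    then show ?thesis
      using continuous_map_compose_app[OF continuous_map_Euclidean_space_component(1)[of m j]
          continuous_map_fst[of "Euclidean_space m" "top_of_set {0::real..}"]] by simp
  qed
  have "homeomorphic_maps ?P (Euclidean_half_space (Suc m)) ?f ?g"
    unfolding homeomorphic_maps_def
  proof (intro conjI)
    show "continuous_map ?P (Euclidean_half_space (Suc m)) ?f"
      unfolding continuous_map_Euclidean_half_space_componentwise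
      using 1 by (auto simp: topspace_Euclidean_space split: nat.split)
    show "continuous_map (Euclidean_half_space (Suc m)) ?P ?g"
      by (auto simp: continuous_map_paired continuous_map_in_subtopology
          continuous_map_Euclidean_space_componentwise continuous_map_Euclidean_space_component
          topspace_Euclidean_half_space)
    show "\<forall>x\<in>topspace (Euclidean_half_space (Suc m)). ?f (?g x) = x"
      by (auto simp: fun_eq_iff split: nat.split)
  qed auto
  then have "germ_homeomorphic ?P (z, t) (Euclidean_half_space (Suc m)) (?f (z, t))"
    using assms by (intro germ_homeomorphic_open_embedding[where V = "topspace (Euclidean_half_space (Suc m))" and g = ?g]) auto
  then show ?thesis by simp
qed

text \<open>A single product chart decides the question: at \<open>t > 0\<close> it yields a
  Euclidean germ, and at \<open>t = 0\<close> invariance of domain excludes every Euclidean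
  germ.\<close>

lemma manifold_boundary_iff_germ:
  fixes t :: real
  assumes "germ_homeomorphic M y (prod_topology (Euclidean_space m) (top_of_set {0..})) (z, t)"
  shows "y \<in> manifold_boundary (Suc m) M \<longleftrightarrow> t = 0"
proof -
  have zt: "z \<in> topspace (Euclidean_space m)" "t \<ge> 0" and y: "y \<in> topspace M"
    using germ_homeomorphic_topspace[OF assms] by auto
  have g: "germ_homeomorphic M y (Euclidean_half_space (Suc m)) (case_nat t z)"
    using germ_homeomorphic_trans[OF assms germ_half_space_product[OF zt]] .
  show ?thesis
  proof
    assume "t = 0"
    then have "\<not> germ_homeomorphic M y (Euclidean_space (Suc m)) w" for w
      using germ_homeomorphic_trans[OF germ_homeomorphic_sym[OF g], of _ w]
        Euclidean_half_space_boundary_germ[of "Suc m" "case_nat t z" w] by auto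
    then show "y \<in> manifold_boundary (Suc m) M"
      using y by (simp add: manifold_boundary_def manifold_interior_iff_germ)
  next
    assume *: "y \<in> manifold_boundary (Suc m) M"
    have "\<not> t > 0"
    proof
      assume "t > 0"
      then have "germ_homeomorphic M y (Euclidean_space (Suc m)) (case_nat t z)"
        using germ_homeomorphic_trans[OF g Euclidean_half_space_interior_germ] germ_homeomorphic_topspace(2)[OF g]
        by simp
      then show False
        using * by (auto simp: manifold_boundary_def manifold_interior_iff_germ)
    qed
    then show "t = 0" using zt by simp
  qed
qed

text \<open>A half-space chart is shrunk to a box around the image of \<open>p\<close>. The test for
  boundary points holds all over the box because each of its points inherits a product germ.\<close>

lemma boundary_product_chart:
  assumes M: "topological_manifold (Suc m) M" and p: "p \<in> manifold_boundary (Suc m) M"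
  obtains B A f g where "openin M B" "p \<in> B" "openin (Euclidean_space m) A"
    "homeomorphic_maps (subtopology M B)
       (prod_topology (subtopology (Euclidean_space m) A) (top_of_set {0..<1::real})) f g"
    "\<And>y. y \<in> B \<Longrightarrow> y \<in> manifold_boundary (Suc m) M \<longleftrightarrow> snd (f y) = 0"
proof -
  let ?E = "Euclidean_space m"
  let ?P = "prod_topology ?E (top_of_set {0::real..})"
  have pM: "p \<in> topspace M"
    using p by (simp add: manifold_boundary_def)
  then obtain q where q: "germ_homeomorphic M p (Euclidean_half_space (Suc m)) q"
    using M by (auto simp: topological_manifold_iff_germ)
  define z where "z i = q (Suc i)" for i
  have "q \<in> topspace (Euclidean_half_space (Suc m))"
    using germ_homeomorphic_topspace(2)[OF q] .
  then have z: "z \<in> topspace ?E" "0 \<le> q 0"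
    by (auto simp: z_def topspace_Euclidean_half_space topspace_Euclidean_space)
  have "case_nat (q 0) z = q"
    by (auto simp: fun_eq_iff z_def split: nat.split)
  then have germ: "germ_homeomorphic M p ?P (z, q 0)"
    using germ_homeomorphic_trans[OF q germ_homeomorphic_sym] germ_half_space_product[OF z] by simp
  then have q0: "q 0 = 0"
    using manifold_boundary_iff_germ[OF germ] p by simp
  obtain U V f g where U: "openin M U" "p \<in> U" "openin ?P V" "(z, 0) \<in> V"
    and fg: "homeomorphic_maps (subtopology M U) (subtopology ?P V) f g" and fp: "f p = (z, 0)"
    using germ unfolding q0 by (rule germ_homeomorphicE)
  have "\<exists>A T. openin ?E A \<and> openin (top_of_set {0::real..}) T \<and> z \<in> A \<and> 0 \<in> T \<and> A \<times> T \<subseteq> V"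
    using U(3)[unfolded openin_prod_topology_alt, rule_format, OF U(4)] .
  then obtain A T where A: "openin ?E A" "openin (top_of_set {0::real..}) T" "z \<in> A" "0 \<in> T" "A \<times> T \<subseteq> V"
    by blast
  obtain e where e: "e > 0" "{0..<e} \<subseteq> T"
  proof -
    obtain S where S: "open S" "T = {0..} \<inter> S"
      using A(2) by (auto simp: openin_open)
    then obtain e where "e > 0" "ball 0 e \<subseteq> S"
      using A(4) openE[of S 0] by auto
    then show thesis
      using S by (intro that[of e]) (auto simp: subset_iff dist_real_def)
  qed
  define N where "N = A \<times> {0..<e}"
  have "openin (top_of_set {0..}) {0..<e}"
    unfolding openin_open by (rule exI[of _ "{..<e}"]) auto
  then have N: "openin ?P N"
    using A(1) by (simp add: N_def openin_prod_Times_iff)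
  have "N \<subseteq> V"
    using A(5) e(2) by (auto simp: N_def)
  then have N': "openin (subtopology ?P V) N"
    using N by (simp add: subset_openin_subtopology)
  define B where "B = {x \<in> topspace (subtopology M U). f x \<in> N}"
  have "B \<subseteq> U" by (auto simp: B_def)
  have "openin (subtopology M U) B"
    and hB: "homeomorphic_maps (subtopology (subtopology M U) B) (subtopology (subtopology ?P V) N) f g"
    unfolding B_def using homeomorphic_maps_preimage_open[OF fg N'] by auto
  then have B: "openin M B"
    using U(1) openin_trans_full by blast
  have hB: "homeomorphic_maps (subtopology M B) (subtopology ?P N) f g"
    using hB \<open>N \<subseteq> V\<close> \<open>B \<subseteq> U\<close> by (simp add: subtopology_subtopology Int_absorb1)
  have PN: "subtopology ?P N = prod_topology (subtopology ?E A) (top_of_set {0..<e})"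
    using e by (simp add: N_def subtopology_Times subtopology_subtopology Int_absorb1 subset_iff)
  \<comment> \<open>Local collars are parametrised by \<open>[0,1)\<close>, so the box of height
    \<open>e\<close> is rescaled.\<close>
  have scale: "continuous_map (top_of_set {0..<a}) (top_of_set {0..<b}) (\<lambda>t. t * c)"
    if "a > 0" "c > 0" "b = a * c" for a b c :: real
    using that by (auto simp: continuous_map_in_subtopology intro!: continuous_intros)
  have "homeomorphic_maps (top_of_set {0..<e}) (top_of_set {0..<1}) (\<lambda>t. t * inverse e) (\<lambda>t. t * e)"
    unfolding homeomorphic_maps_def using scale[of e "inverse e" 1] scale[of 1 e e] e(1) by auto
  moreover have "homeomorphic_maps (subtopology ?E A) (subtopology ?E A) id id"
    by (simp only: homeomorphic_maps_id)
  ultimately have "homeomorphic_maps (subtopology ?P N)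
      (prod_topology (subtopology ?E A) (top_of_set {0..<1}))
      (\<lambda>(x, y). (id x, y * inverse e)) (\<lambda>(x, y). (id x, y * e))"
    unfolding PN homeomorphic_maps_prod by blast
  then have h: "homeomorphic_maps (subtopology M B) (prod_topology (subtopology ?E A) (top_of_set {0..<1}))
      ((\<lambda>(x, y). (id x, y * inverse e)) \<circ> f) (g \<circ> (\<lambda>(x, y). (id x, y * e)))"
    using hB homeomorphic_maps_compose by blast
  show thesis
  proof (rule that[OF B _ A(1) h])
    show "p \<in> B"
      using pM U(2) A(3) fp e(1) by (auto simp: B_def N_def)
    show "y \<in> manifold_boundary (Suc m) M \<longleftrightarrow> snd (((\<lambda>(x, y). (id x, y * inverse e)) \<circ> f) y) = 0"
      if "y \<in> B" for y
    proof -
      have "germ_homeomorphic M y ?P (f y)"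
        using that B N hB by (intro germ_homeomorphicI) auto
      then show ?thesis
        using manifold_boundary_iff_germ[of M y m "fst (f y)" "snd (f y)"] e(1)
        by (simp add: case_prod_unfold)
    qed
  qed
qed

text \<open>In a product chart the depth is the last coordinate: \<open>k\<close> sets it to
  \<open>t\<close>, \<open>\<rho>\<close> resets it to 0, and \<open>d\<close> reads it off.\<close>

lemma manifold_boundary_local_collar:
  assumes M: "topological_manifold (Suc m) M" and p: "p \<in> manifold_boundary (Suc m) M"
  shows "\<exists>U B k \<rho> d. local_collar M (manifold_boundary (Suc m) M) U B k \<rho> d \<and> p \<in> U"
proof -
  let ?D = "manifold_boundary (Suc m) M" and ?I = "top_of_set {0..<1::real}"
  obtain B A f g where B: "openin M B" "p \<in> B" "openin (Euclidean_space m) A"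
    and h: "homeomorphic_maps (subtopology M B) (prod_topology (subtopology (Euclidean_space m) A) ?I) f g"
    and fD: "\<And>y. y \<in> B \<Longrightarrow> y \<in> ?D \<longleftrightarrow> snd (f y) = 0"
    using boundary_product_chart[OF M p] by metis
  have topB: "topspace (subtopology M B) = B" and topA: "topspace (subtopology (Euclidean_space m) A) = A"
    using B(1,3) openin_subset by fastforce+
  let ?P = "prod_topology (subtopology (Euclidean_space m) A) ?I"
  note f = homeomorphic_mapsD[OF h]
  have fB: "fst (f y) \<in> A" "0 \<le> snd (f y)" "snd (f y) < 1" if "y \<in> B" for y
    using f(3)[of y] that topA topB by (auto simp: mem_Times_iff)
  have gB: "g (z, t) \<in> B" "f (g (z, t)) = (z, t)" if "z \<in> A" "0 \<le> t" "t < 1" for z t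
    using f(4,6)[of "(z, t)"] that topA topB by auto
  have gf: "g (f y) = y" if "y \<in> B" for y
    using f(5)[of y] that topB by auto
  have cfst: "continuous_map (subtopology M B) (subtopology (Euclidean_space m) A) (\<lambda>y. fst (f y))"
    by (rule continuous_map_compose_app[OF continuous_map_fst f(1)])
  have csnd: "continuous_map (subtopology M B) ?I (\<lambda>y. snd (f y))"
    by (rule continuous_map_compose_app[OF continuous_map_snd f(1)])
  have "continuous_map (prod_topology (subtopology M (B \<inter> ?D)) ?I) (subtopology M B) (\<lambda>z. g (fst (f (fst z)), snd z))"
  proof (rule continuous_map_compose_pair[OF f(2) continuous_map_compose_app[OF cfst] continuous_map_snd])
    show "continuous_map (prod_topology (subtopology M (B \<inter> ?D)) ?I) (subtopology M B) fst"
      using continuous_map_fst[of "subtopology M (B \<inter> ?D)" ?I] by (auto simp: continuous_map_in_subtopology)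
  qed
  moreover have "continuous_map (subtopology M B) (subtopology M (B \<inter> ?D)) (\<lambda>y. g (fst (f y), 0))"
  proof -
    have "continuous_map (subtopology M B) (subtopology M B) (\<lambda>y. g (fst (f y), 0))"
      by (rule continuous_map_compose_pair[OF f(2) cfst]) auto
    then show ?thesis
      using fB gB fD topB by (auto simp: continuous_map_in_subtopology)
  qed
  ultimately have "local_collar M ?D (B \<inter> ?D) B (\<lambda>z. g (fst (f (fst z)), snd z)) (\<lambda>y. g (fst (f y), 0)) (\<lambda>y. snd (f y))"
    unfolding local_collar_def
  proof (intro conjI ballI)
    show "g (fst (f (fst (x, 0))), snd (x, 0)) = x" if "x \<in> B \<inter> ?D" for x
      using that fD[of x] gf[of x] by (metis IntD1 IntD2 fst_conv prod.collapse snd_conv)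
    show "g (fst (f (g (fst (f (fst (x, t))), snd (x, t)))), 0) = x" if "x \<in> B \<inter> ?D" "t \<in> {0..<1}" for x t
      using that fD[of x] gf[of x] gB[of "fst (f x)" t] fB[of x]
      by simp (metis prod.collapse)
  qed (use B csnd fB gB gf in auto)
  moreover have "p \<in> B \<inter> ?D"
    using B p by auto
  ultimately show ?thesis by blast
qed

text \<open>The slice at depth 0 of a product chart is a Euclidean chart of the boundary.\<close>

lemma manifold_boundary_germ:
  assumes M: "topological_manifold (Suc m) M" and p: "p \<in> manifold_boundary (Suc m) M"
  shows "\<exists>z. germ_homeomorphic (subtopology M (manifold_boundary (Suc m) M)) p (Euclidean_space m) z"
proof -
  let ?D = "manifold_boundary (Suc m) M" and ?I = "top_of_set {0..<1::real}"
  obtain B A f g where B: "openin M B" "p \<in> B" "openin (Euclidean_space m) A"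
    and h: "homeomorphic_maps (subtopology M B) (prod_topology (subtopology (Euclidean_space m) A) ?I) f g"
    and fD: "\<And>y. y \<in> B \<Longrightarrow> y \<in> ?D \<longleftrightarrow> snd (f y) = 0"
    using boundary_product_chart[OF M p] by metis
  have topB: "topspace (subtopology M B) = B" and topA: "topspace (subtopology (Euclidean_space m) A) = A"
    using B(1,3) openin_subset by fastforce+
  note f = homeomorphic_mapsD[OF h]
  have "continuous_map (subtopology M B) (subtopology (Euclidean_space m) A) (\<lambda>y. fst (f y))"
    by (rule continuous_map_compose_app[OF continuous_map_fst f(1)])
  then have "continuous_map (subtopology (subtopology M B) ?D) (subtopology (Euclidean_space m) A) (\<lambda>y. fst (f y))"
    by (rule continuous_map_from_subtopology)
  then have 1: "continuous_map (subtopology (subtopology M ?D) (B \<inter> ?D)) (subtopology (Euclidean_space m) A) (\<lambda>y. fst (f y))"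
    by (simp add: subtopology_subtopology Int_ac)
  have "continuous_map (subtopology (Euclidean_space m) A) (subtopology M B) (\<lambda>w. g (w, 0))"
    by (rule continuous_map_compose_pair[OF f(2)]) auto
  moreover have "g (w, 0) \<in> B \<inter> ?D" if "w \<in> A" for w
  proof -
    have "(w, 0::real) \<in> topspace (prod_topology (subtopology (Euclidean_space m) A) ?I)"
      using that topA by simp
    from f(4,6)[OF this] show ?thesis
      using fD[of "g (w, 0)"] topB by simp
  qed
  ultimately have 2: "continuous_map (subtopology (Euclidean_space m) A) (subtopology (subtopology M ?D) (B \<inter> ?D)) (\<lambda>w. g (w, 0))"
    unfolding continuous_map_in_subtopology Pi_iff topA by blast
  have "homeomorphic_maps (subtopology (subtopology M ?D) (B \<inter> ?D)) (subtopology (Euclidean_space m) A)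
      (\<lambda>y. fst (f y)) (\<lambda>w. g (w, 0))"
    unfolding homeomorphic_maps_def
  proof (intro conjI ballI 1 2)
    show "g (fst (f x), 0) = x" if "x \<in> topspace (subtopology (subtopology M ?D) (B \<inter> ?D))" for x
      using that f(5)[of x] fD[of x] topB by (metis Int_iff prod.collapse topspace_subtopology)
    show "fst (f (g (w, 0))) = w" if "w \<in> topspace (subtopology (Euclidean_space m) A)" for w
      using that f(6)[of "(w, 0)"] by simp
  qed
  moreover have "openin (subtopology M ?D) (B \<inter> ?D)"
    using B(1) openin_subtopology_Int by blast
  ultimately show ?thesis
    using B(2,3) p by (blast intro: germ_homeomorphicI)
qed

text \<open>Boundary points have Euclidean germs within the boundary, so it has no boundary points
  of its own. The assumption \<open>m \<ge> 1\<close> allows these germs to be turned into the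
  half-space germs demanded of a manifold.\<close>

lemma closed_manifold_boundary:
  assumes M: "topological_manifold (Suc m) M" and "compact_space M" and m: "m \<ge> 1"
  shows "closed_manifold m (subtopology M (manifold_boundary (Suc m) M))"
proof -
  let ?D = "manifold_boundary (Suc m) M"
  have topD: "topspace (subtopology M ?D) = ?D"
    by (auto simp: manifold_boundary_def)
  have "topological_manifold m (subtopology M ?D)"
    unfolding topological_manifold_iff_germ topD
  proof (intro conjI ballI)
    show "Hausdorff_space (subtopology M ?D)" "second_countable (subtopology M ?D)"
      using M by (simp_all add: topological_manifold_iff_germ Hausdorff_space_subtopology second_countable_subtopology)
    fix p assume "p \<in> ?D"
    then obtain z where z: "germ_homeomorphic (subtopology M ?D) p (Euclidean_space m) z"
      using manifold_boundary_germ[OF M] by blast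
    obtain r where "germ_homeomorphic (Euclidean_space m) z (Euclidean_half_space m) r"
      using Euclidean_space_germ_half_space[OF m germ_homeomorphic_topspace(2)[OF z]] by blast
    then show "\<exists>q. germ_homeomorphic (subtopology M ?D) p (Euclidean_half_space m) q"
      by (intro exI germ_homeomorphic_trans[OF z])
  qed
  moreover have "compact_space (subtopology M ?D)"
    using assms(2) closedin_manifold_boundary closedin_compact_space compact_space_subtopology by blast
  moreover have "?D \<subseteq> manifold_interior m (subtopology M ?D)"
    using manifold_boundary_germ[OF M] unfolding subset_iff manifold_interior_iff_germ by blast
  then have "manifold_boundary m (subtopology M ?D) = {}"
    unfolding manifold_boundary_def[of m "subtopology M ?D"] topD by blast
  ultimately show ?thesis
    by (simp add: closed_manifold_def)
qed

section \<open>Extending maps and homotopies from the boundary\<close>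

abbreviation unit_interval :: "real topology" where
  "unit_interval \<equiv> top_of_set {0..1}"

lemma continuous_map_unit_interval:
  "continuous_map X unit_interval f \<longleftrightarrow>
     continuous_map X euclideanreal f \<and> (\<forall>x \<in> topspace X. 0 \<le> f x \<and> f x \<le> 1)"
  by (auto simp: continuous_map_in_subtopology)

text \<open>The part of a collar that homotopy arguments use. \<open>u\<close> and \<open>h\<close>
  make \<open>D\<close> a neighbourhood deformation retract, with the neighbourhood
  \<open>u \<le> 1/2\<close> collapsed onto \<open>D\<close>; \<open>p\<close> moves all points off
  \<open>D\<close> at every positive time.\<close>

locale boundary_pair =
  fixes M :: "'a topology" and D :: "'a set" and u :: "'a \<Rightarrow> real" and h p :: "real \<times> 'a \<Rightarrow> 'a"
  assumes D_sub: "D \<subseteq> topspace M"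
    and cont_u: "continuous_map M unit_interval u"
    and u_zero: "x \<in> topspace M \<Longrightarrow> u x = 0 \<longleftrightarrow> x \<in> D"
    and cont_h: "continuous_map (prod_topology unit_interval M) M h"
    and h_0: "x \<in> topspace M \<Longrightarrow> h (0, x) = x"
    and h_D: "x \<in> D \<Longrightarrow> 0 \<le> r \<Longrightarrow> r \<le> 1 \<Longrightarrow> h (r, x) = x"
    and h_1: "x \<in> topspace M \<Longrightarrow> u x \<le> 1/2 \<Longrightarrow> h (1, x) \<in> D"
    and cont_p: "continuous_map (prod_topology unit_interval M) M p"
    and p_0: "x \<in> topspace M \<Longrightarrow> p (0, x) = x"
    and p_pos: "x \<in> topspace M \<Longrightarrow> 0 < r \<Longrightarrow> r \<le> 1 \<Longrightarrow> p (r, x) \<notin> D"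

text \<open>The homeomorphism onto the extended space is split into position \<open>c\<close> and
  height \<open>s\<close>. \<open>D\<close> becomes the outer end of the external collar, so it is
  the level \<open>s = 1\<close>.\<close>

lemma collared_coordinates:
  assumes "collared M D (\<lambda>_. 1)" and D: "D \<subseteq> topspace M"
  obtains c s G' where "continuous_map M M c" "continuous_map M euclideanreal s"
    "continuous_map (collar_extension M D (\<lambda>_. 1)) M G'"
    "\<And>x. x \<in> topspace M \<Longrightarrow> c x \<in> topspace M \<and> 0 \<le> s x \<and> s x \<le> 1 \<and> (s x = 0 \<or> c x \<in> D)"
    "\<And>x. x \<in> topspace M \<Longrightarrow> G' (c x, s x) = x"
    "\<And>x. x \<in> topspace M \<Longrightarrow> s x = 1 \<longleftrightarrow> x \<in> D"
    "\<And>x. x \<in> D \<Longrightarrow> c x = x"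
    "\<And>z. z \<in> topspace (collar_extension M D (\<lambda>_. 1)) \<Longrightarrow> c (G' z) = fst z \<and> s (G' z) = snd z"
proof -
  let ?E = "collar_extension M D (\<lambda>_. 1)"
  obtain G G' where G: "homeomorphic_maps M ?E G G'" and GD: "\<And>x. x \<in> D \<Longrightarrow> G x = (x, 1)"
    using assms(1) by (auto simp: collared_def homeomorphic_map_maps)
  define c where "c x = fst (G x)" for x
  define s where "s x = snd (G x)" for x
  have cG: "continuous_map M ?E G" and cG': "continuous_map ?E M G'"
    and G'G: "\<And>x. x \<in> topspace M \<Longrightarrow> G' (G x) = x"
    and GG': "\<And>z. z \<in> topspace ?E \<Longrightarrow> G (G' z) = z"
    using G by (auto simp: homeomorphic_maps_def)
  show thesis
  proof (rule that[OF _ _ cG'])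
    show "continuous_map M M c" "continuous_map M euclideanreal s"
      using cG by (auto simp: collar_extension_def continuous_map_in_subtopology
          s_def[abs_def] c_def[abs_def] continuous_map_pairwise o_def)
    show *: "c x \<in> topspace M \<and> 0 \<le> s x \<and> s x \<le> 1 \<and> (s x = 0 \<or> c x \<in> D)" if "x \<in> topspace M" for x
      using continuous_map_in[OF cG that] by (auto simp: topspace_collar_extension c_def s_def)
    show cs: "G' (c x, s x) = x" if "x \<in> topspace M" for x
      using G'G[OF that] by (simp add: c_def s_def)
    show cD: "c x = x" if "x \<in> D" for x
      using GD[OF that] by (simp add: c_def)
    show "s x = 1 \<longleftrightarrow> x \<in> D" if x: "x \<in> topspace M" for x
    proof
      assume "s x = 1"
      then have "c x \<in> D" "G' (c x, 1) = x"
        using *[OF x] cs[OF x] by auto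
      moreover from this have "G' (c x, 1) = c x"
        using G'G[of "c x"] GD[of "c x"] D by auto
      ultimately show "x \<in> D" by simp
    qed (simp add: s_def GD)
    show "c (G' z) = fst z \<and> s (G' z) = snd z" if "z \<in> topspace ?E" for z
      using GG'[OF that] by (simp add: c_def s_def)
  qed
qed

lemma collared_imp_boundary_pair:
  assumes "collared M D (\<lambda>_. 1)" and D: "D \<subseteq> topspace M"
  shows "\<exists>u h p. boundary_pair M D u h p"
proof -
  let ?E = "collar_extension M D (\<lambda>_. 1)"
  obtain c s G' where cc: "continuous_map M M c" and cs: "continuous_map M euclideanreal s"
    and cG': "continuous_map ?E M G'"
    and cs_in: "\<And>x. x \<in> topspace M \<Longrightarrow> c x \<in> topspace M \<and> 0 \<le> s x \<and> s x \<le> 1 \<and> (s x = 0 \<or> c x \<in> D)"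
    and G'cs: "\<And>x. x \<in> topspace M \<Longrightarrow> G' (c x, s x) = x"
    and sD: "\<And>x. x \<in> topspace M \<Longrightarrow> s x = 1 \<longleftrightarrow> x \<in> D" and cD: "\<And>x. x \<in> D \<Longrightarrow> c x = x"
    and csG': "\<And>z. z \<in> topspace ?E \<Longrightarrow> c (G' z) = fst z \<and> s (G' z) = snd z"
    using collared_coordinates[OF assms] by blast
  have s: "c x \<in> topspace M" "0 \<le> s x" "s x \<le> 1" "s x = 0 \<or> c x \<in> D" if "x \<in> topspace M" for x
    using cs_in[OF that] by auto
  have G'D: "G' (x, 1) = x" if "x \<in> D" for x
    using G'cs[of x] sD[of x] cD[OF that] that D by auto
  have inE: "(c x, t) \<in> topspace ?E" if "x \<in> topspace M" "0 \<le> t" "t \<le> 1" "s x = 0 \<Longrightarrow> t = 0" for x t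
    using s[OF that(1)] that by (auto simp: topspace_collar_extension)
  \<comment> \<open>Both deformations alter only the height. Height 0 has to be preserved, because
    there the position need not lie in \<open>D\<close> and no fibre is available.\<close>
  have scale: "continuous_map (prod_topology unit_interval M) M (\<lambda>z. G' (c (snd z), w z))"
    if "continuous_map (prod_topology unit_interval M) euclideanreal w"
      "\<And>r x. 0 \<le> r \<Longrightarrow> r \<le> 1 \<Longrightarrow> x \<in> topspace M \<Longrightarrow> 0 \<le> w (r, x) \<and> w (r, x) \<le> 1"
      "\<And>r x. 0 \<le> r \<Longrightarrow> r \<le> 1 \<Longrightarrow> x \<in> topspace M \<Longrightarrow> s x = 0 \<Longrightarrow> w (r, x) = 0" for w
  proof (rule continuous_map_compose_app[OF cG'])
    show "continuous_map (prod_topology unit_interval M) ?E (\<lambda>z. (c (snd z), w z))"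
      unfolding collar_extension_def continuous_map_in_subtopology continuous_map_paired
    proof (intro conjI)
      show "continuous_map (prod_topology unit_interval M) M (\<lambda>x. c (snd x))"
        by (rule continuous_map_compose_app[OF cc continuous_map_snd])
      show "(\<lambda>z. (c (snd z), w z)) \<in> topspace (prod_topology unit_interval M) \<rightarrow>
              {(x, s). s = 0 \<or> x \<in> D \<and> 0 \<le> s \<and> s \<le> 1}"
        using s(4) that(2,3) by fastforce
    qed (rule that(1))
  qed
  have c1: "continuous_map (prod_topology unit_interval M) euclideanreal (\<lambda>z. s (snd z))"
    by (rule continuous_map_compose_app[OF cs continuous_map_snd])
  have c2: "continuous_map (prod_topology unit_interval M) euclideanreal fst"
    using continuous_map_fst[of unit_interval M] by (simp add: continuous_map_in_subtopology)
  \<comment> \<open>At time 1 the height is doubled and capped at 1, so all points of height at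
    least 1/2, that is \<open>u \<le> 1/2\<close>, reach \<open>D\<close>.\<close>
  define h where "h z = G' (c (snd z), min 1 ((1 + fst z) * s (snd z)))" for z
  \<comment> \<open>The factor is below 1 as soon as time is positive, so height 1 is left at
    once.\<close>
  define p where "p z = G' (c (snd z), s (snd z) * (1 - fst z / 2))" for z
  have w: "0 \<le> s x * (1 - r / 2)" "s x * (1 - r / 2) \<le> 1" "0 < r \<Longrightarrow> s x * (1 - r / 2) < 1"
    if "x \<in> topspace M" "0 \<le> r" "r \<le> 1" for x r
  proof -
    show "0 \<le> s x * (1 - r / 2)" using s[OF that(1)] that by simp
    show "s x * (1 - r / 2) \<le> 1" using s[OF that(1)] that by (simp add: mult_le_one)
    have "s x * (1 - r / 2) \<le> 1 * (1 - r / 2)"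
      using s[OF that(1)] that by (intro mult_right_mono) auto
    also assume "0 < r"
    then have "1 * (1 - r / 2) < 1" by simp
    finally show "s x * (1 - r / 2) < 1" .
  qed
  have "continuous_map (prod_topology unit_interval M) M h"
    unfolding h_def[abs_def]
  proof (rule scale)
    show "continuous_map (prod_topology unit_interval M) euclideanreal
            (\<lambda>z. min 1 ((1 + fst z) * s (snd z)))"
      by (intro continuous_map_real_min continuous_map_real_mult continuous_map_add c1 c2) auto
    show "0 \<le> min 1 ((1 + fst (r, x)) * s (snd (r, x))) \<and> min 1 ((1 + fst (r, x)) * s (snd (r, x))) \<le> 1"
      if "0 \<le> r" "x \<in> topspace M" for r x
      using s(2)[OF that(2)] that(1) by simp
  qed simp
  moreover have "continuous_map (prod_topology unit_interval M) M p"
    unfolding p_def[abs_def]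
  proof (rule scale)
    show "continuous_map (prod_topology unit_interval M) euclideanreal (\<lambda>z. s (snd z) * (1 - fst z / 2))"
      by (intro continuous_map_real_mult continuous_map_diff continuous_map_real_divide c1 c2) auto
  qed (use w(1,2) in simp_all)
  moreover have "continuous_map M unit_interval (\<lambda>x. 1 - s x)"
    unfolding continuous_map_unit_interval using s(2,3) by (simp add: continuous_map_diff cs)
  moreover have "h (0, x) = x" "p (0, x) = x" if "x \<in> topspace M" for x
    using G'cs[OF that] s(3)[OF that] by (simp_all add: h_def p_def)
  moreover have "h (r, x) = x" if "x \<in> D" "0 \<le> r" "r \<le> 1" for r x
    using G'D[OF that(1)] cD[OF that(1)] sD[of x] that D by (auto simp: h_def)
  moreover have "h (1, x) \<in> D" if "x \<in> topspace M" "1 - s x \<le> 1/2" for x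
  proof -
    have "min 1 ((1 + 1) * s x) = 1" "c x \<in> D"
      using s(4)[OF that(1)] that(2) by auto
    then show ?thesis
      by (simp add: h_def G'D)
  qed
  moreover have "p (r, x) \<notin> D" if "x \<in> topspace M" "0 < r" "r \<le> 1" for r x
  proof
    assume "p (r, x) \<in> D"
    then have "s (p (r, x)) = 1"
      using sD D by auto
    moreover have "s (p (r, x)) = s x * (1 - r / 2)"
      unfolding p_def using csG'[OF inE[OF that(1), of "s x * (1 - r / 2)"]] w[of x r] that by simp
    ultimately show False
      using w(3)[of x r] that by auto
  qed
  ultimately have "boundary_pair M D (\<lambda>x. 1 - s x) h p"
    using D sD by unfold_locales auto
  then show ?thesis by blast
qed

section \<open>Maps and homotopies into contractible spaces\<close>

lemma contractible_space_homotopyE: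
  assumes "contractible_space Y"
  obtains H c where "continuous_map (prod_topology unit_interval Y) Y H"
    "\<And>y. y \<in> topspace Y \<Longrightarrow> H (0, y) = y" "\<And>y. H (1, y) = c"
proof -
  obtain c H where "continuous_map (prod_topology unit_interval Y) Y H"
      "\<forall>y. H (0, y) = id y" "\<forall>y. H (1, y) = c"
    using assms unfolding contractible_space_def homotopic_with_def by blast
  then show thesis
    using that[of H c] by simp
qed

lemma homotopic_withI:
  assumes "continuous_map (prod_topology unit_interval X) Y h"
    and "\<And>x. x \<in> topspace X \<Longrightarrow> h (0, x) = f x" "\<And>x. x \<in> topspace X \<Longrightarrow> h (1, x) = g x"
    and "\<And>t. 0 \<le> t \<Longrightarrow> t \<le> 1 \<Longrightarrow> P (\<lambda>x. h (t, x))"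
    and "\<And>j k. (\<And>x. x \<in> topspace X \<Longrightarrow> j x = k x) \<Longrightarrow> P j \<longleftrightarrow> P k"
  shows "homotopic_with P X Y f g"
proof (subst homotopic_with)
  show "\<exists>h. continuous_map (prod_topology unit_interval X) Y h \<and>
      (\<forall>x\<in>topspace X. h (0, x) = f x) \<and> (\<forall>x\<in>topspace X. h (1, x) = g x) \<and>
      (\<forall>t\<in>{0..1}. P (\<lambda>x. h (t, x)))"
    using assms(1-4) by (intro exI[of _ h]) simp
qed (rule assms(5))

context boundary_pair
begin

definition crush :: "'a \<Rightarrow> 'a" where "crush x = h (1, x)"

lemma u_bounds: "x \<in> topspace M \<Longrightarrow> 0 \<le> u x" "x \<in> topspace M \<Longrightarrow> u x \<le> 1"
  using cont_u by (auto simp: continuous_map_unit_interval)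

lemma cont_u_real: "continuous_map M euclideanreal u"
  using cont_u by (simp add: continuous_map_unit_interval)

lemma cont_crush: "continuous_map M M crush"
  unfolding crush_def[abs_def] by (rule continuous_map_compose_pair[OF cont_h]) auto

lemma cont_crush_collar:
  "continuous_map (subtopology M {x \<in> topspace M. u x \<le> 1/2}) (subtopology M D) crush"
  using cont_crush h_1 by (auto simp: crush_def continuous_map_in_subtopology continuous_map_from_subtopology)

lemma crush_D: "x \<in> D \<Longrightarrow> crush x = x"
  by (simp add: crush_def h_D)

text \<open>Near \<open>D\<close> points are first crushed to \<open>D\<close>, where
  \<open>f\<close> is defined. The contraction of \<open>Y\<close>, run at time
  \<open>2 * u x\<close>, has arrived at the constant \<open>c\<close> when
  \<open>u x = 1/2\<close>, where crushing may stop landing in \<open>D\<close>.\<close>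

lemma extension_contractible:
  assumes Y: "contractible_space Y" "topspace Y \<noteq> {}"
    and f: "continuous_map (subtopology M D) Y f"
  obtains F where "continuous_map M Y F" "\<And>x. x \<in> D \<Longrightarrow> F x = f x"
proof -
  obtain H c where H: "continuous_map (prod_topology unit_interval Y) Y H"
    "\<And>y. y \<in> topspace Y \<Longrightarrow> H (0, y) = y" "\<And>y. H (1, y) = c"
    using contractible_space_homotopyE[OF Y(1)] by metis
  \<comment> \<open>The empty space is contractible too; nonemptiness of \<open>Y\<close> puts the
    value of the constant map inside \<open>Y\<close>.\<close>
  have c: "c \<in> topspace Y"
    using continuous_map_in[OF H(1), of "(1, y)" for y] H(3) Y(2) by force
  define F where "F x = (if u x \<le> 1/2 then H (min 1 (2 * u x), f (crush x)) else c)" for x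
  have "continuous_map M Y F"
    unfolding F_def
  proof (rule continuous_map_cases_le)
    show "continuous_map (subtopology M {x \<in> topspace M. u x \<le> 1 / 2}) Y
            (\<lambda>x. H (min 1 (2 * u x), f (crush x)))"
    proof (rule continuous_map_compose_pair[OF H(1)])
      show "continuous_map (subtopology M {x \<in> topspace M. u x \<le> 1 / 2}) unit_interval
              (\<lambda>x. min 1 (2 * u x))"
        unfolding continuous_map_unit_interval using u_bounds
        by (auto intro!: continuous_map_real_min continuous_map_real_mult
              continuous_map_from_subtopology cont_u_real)
      show "continuous_map (subtopology M {x \<in> topspace M. u x \<le> 1 / 2}) Y (\<lambda>x. f (crush x))"
        by (rule continuous_map_compose_app[OF f cont_crush_collar])
    qed
  qed (use c H(3) cont_u_real in auto)
  moreover have "F x = f x" if "x \<in> D" for x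
    using that D_sub u_zero[of x] H(2)[of "f x"] continuous_map_in[OF f, of x]
    by (auto simp: F_def crush_D)
  ultimately show thesis
    by (rule that)
qed

text \<open>Each map is deformed to a normal form that depends only on its values on
  \<open>D\<close>: crushed and partly contracted on \<open>u \<le> 1/2\<close>, constant beyond.
  Maps agreeing on \<open>D\<close> share this form, and the deformations are fixed on
  \<open>D\<close>.\<close>

lemma homotopic_agree_on_boundary:
  fixes Y :: "'b topology" and D' :: "'b set"
  defines "P \<equiv> \<lambda>f. f ` D \<subseteq> D'"
  assumes Y: "contractible_space Y"
    and f: "continuous_map M Y f" "f ` D \<subseteq> D'" and g: "continuous_map M Y g"
    and fg: "\<And>x. x \<in> D \<Longrightarrow> f x = g x"
  shows "homotopic_with P M Y f g"
proof -
  obtain H c where H: "continuous_map (prod_topology unit_interval Y) Y H"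
    "\<And>y. y \<in> topspace Y \<Longrightarrow> H (0, y) = y" "\<And>y. H (1, y) = c"
    using contractible_space_homotopyE[OF Y] by metis
  have P_cong: "P j \<longleftrightarrow> P k" if "\<And>x. x \<in> topspace M \<Longrightarrow> j x = k x" for j k
    using that D_sub unfolding P_def by (metis image_cong subsetD)
  define w where "w x = min 1 (2 * u x)" for x
  have wb: "0 \<le> w x \<and> w x \<le> 1" if "x \<in> topspace M" for x
    using u_bounds[OF that] by (auto simp: w_def)
  have cw: "continuous_map M euclideanreal w"
    unfolding w_def by (auto intro!: continuous_map_real_min continuous_map_real_mult cont_u_real)
  have homotopic: "homotopic_with P M Y f (\<lambda>x. H (w x, f (crush x)))"
    if cf: "continuous_map M Y f" and fD: "f ` D \<subseteq> D'" for f
  proof (rule homotopic_with_trans)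
    let ?I = "prod_topology unit_interval M"
    have cfst: "continuous_map ?I euclideanreal fst" "continuous_map ?I unit_interval fst"
      using continuous_map_fst[of unit_interval M] by (auto simp: continuous_map_in_subtopology)
    show "homotopic_with P M Y f (\<lambda>x. f (crush x))"
    proof (rule homotopic_withI[where h = "\<lambda>z. f (h z)", OF _ _ _ _ P_cong])
      show "continuous_map (prod_topology unit_interval M) Y (\<lambda>z. f (h z))"
        by (rule continuous_map_compose_app[OF cf cont_h])
    qed (use fD h_0 h_D in \<open>auto simp: crush_def P_def\<close>)
    show "homotopic_with P M Y (\<lambda>x. f (crush x)) (\<lambda>x. H (w x, f (crush x)))"
    proof (rule homotopic_withI[where h = "\<lambda>z. H (fst z * w (snd z), f (crush (snd z)))", OF _ _ _ _ P_cong])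
      have "continuous_map ?I unit_interval (\<lambda>z. fst z * w (snd z))"
        unfolding continuous_map_unit_interval using wb
        by (auto intro!: continuous_map_real_mult cfst continuous_map_compose_app[OF cw]
              continuous_map_snd mult_le_one)
      then show "continuous_map ?I Y (\<lambda>z. H (fst z * w (snd z), f (crush (snd z))))"
        by (rule continuous_map_compose_pair[OF H(1)])
          (intro continuous_map_compose_app[OF cf] continuous_map_compose_app[OF cont_crush] continuous_map_snd)
      show "P (\<lambda>x. H (fst (t, x) * w (snd (t, x)), f (crush (snd (t, x)))))" for t
      proof -
        have "H (t * w x, f (crush x)) = f x" if "x \<in> D" for x
          using that D_sub u_zero[of x] H(2)[of "f x"] continuous_map_in[OF cf, of x]
          by (auto simp: w_def crush_D)
        then show ?thesis
          using fD by (auto simp: P_def)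
      qed
    qed (use H(2) continuous_map_in[OF cf] continuous_map_in[OF cont_crush] in auto)
  qed
  have gD: "g ` D \<subseteq> D'"
    using f(2) fg by auto
  have e: "H (w x, f (crush x)) = H (w x, g (crush x))" if "x \<in> topspace M" for x
  proof (cases "u x \<le> 1/2")
    case True
    then show ?thesis
      using fg h_1[OF that] by (simp add: crush_def)
  next
    case False
    then show ?thesis
      using H(3) by (simp add: w_def)
  qed
  have "homotopic_with P M Y (\<lambda>x. H (w x, f (crush x))) g"
    by (intro homotopic_with_eq[OF homotopic_with_symD[OF homotopic[OF g gD]]] e refl P_cong)
  with homotopic[OF f] show ?thesis
    by (rule homotopic_with_trans)
qed

text \<open>The boundary homotopy is spread over the collar and damped to its initial stage at
  \<open>u = 1/2\<close>. The resulting ends agree with \<open>f\<close> and \<open>g\<close> on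
  \<open>D\<close> only; contractibility of \<open>Y\<close> makes up for the difference
  elsewhere.\<close>

lemma homotopic_of_boundary_homotopy:
  fixes Y :: "'b topology" and D' :: "'b set"
  defines "P \<equiv> \<lambda>f. f ` D \<subseteq> D'"
  assumes Y: "contractible_space Y"
    and f: "continuous_map M Y f" "f ` D \<subseteq> D'" and g: "continuous_map M Y g"
    and hom: "homotopic_with (\<lambda>_. True) (subtopology M D) (subtopology Y D') f g"
  shows "homotopic_with P M Y f g"
proof -
  let ?I = "prod_topology unit_interval M"
  have P_cong: "P j \<longleftrightarrow> P k" if "\<And>x. x \<in> topspace M \<Longrightarrow> j x = k x" for j k
    using that D_sub unfolding P_def by (metis image_cong subsetD)
  obtain \<gamma> where \<gamma>: "continuous_map (prod_topology unit_interval (subtopology M D)) (subtopology Y D') \<gamma>"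
    "\<And>x. \<gamma> (0, x) = f x" "\<And>x. \<gamma> (1, x) = g x"
    using hom unfolding homotopic_with_def by auto
  have \<gamma>D: "\<gamma> (t, x) \<in> D'" if "0 \<le> t" "t \<le> 1" "x \<in> D" for t x
    using \<gamma>(1) that D_sub by (auto simp: continuous_map_in_subtopology)
  note \<gamma>Y = \<gamma>(1)[unfolded continuous_map_in_subtopology, THEN conjunct1]
  \<comment> \<open>The damping factor is 1 on \<open>D\<close> and 0 at \<open>u = 1/2\<close>,
    where \<open>\<gamma>\<close> has become \<open>f\<close> and the two branches meet.\<close>
  define K where "K z = (if u (snd z) \<le> 1/2 then \<gamma> (fst z * max 0 (1 - 2 * u (snd z)), crush (snd z))
    else f (crush (snd z)))" for z
  have cu: "continuous_map ?I euclideanreal (\<lambda>z. u (snd z))"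
    by (rule continuous_map_compose_app[OF cont_u_real continuous_map_snd])
  have cfst: "continuous_map ?I euclideanreal fst"
    using continuous_map_fst[of unit_interval M] by (auto simp: continuous_map_in_subtopology)
  have cK: "continuous_map ?I Y K"
    unfolding K_def
  proof (rule continuous_map_cases_le)
    let ?Z = "subtopology ?I {z \<in> topspace ?I. u (snd z) \<le> 1/2}"
    show "continuous_map ?Z Y (\<lambda>z. \<gamma> (fst z * max 0 (1 - 2 * u (snd z)), crush (snd z)))"
    proof (rule continuous_map_compose_pair[OF \<gamma>Y])
      show "continuous_map ?Z unit_interval (\<lambda>z. fst z * max 0 (1 - 2 * u (snd z)))"
        unfolding continuous_map_unit_interval using u_bounds
        by (auto intro!: continuous_map_real_mult continuous_map_real_max continuous_map_diff
              continuous_map_from_subtopology cu cfst mult_le_one)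
      have "continuous_map ?Z M (\<lambda>z. crush (snd z))"
        by (intro continuous_map_from_subtopology continuous_map_compose_app[OF cont_crush] continuous_map_snd)
      then show "continuous_map ?Z (subtopology M D) (\<lambda>z. crush (snd z))"
        using h_1 by (auto simp: continuous_map_in_subtopology crush_def)
    qed
    show "continuous_map (subtopology ?I {z \<in> topspace ?I. 1/2 \<le> u (snd z)}) Y (\<lambda>z. f (crush (snd z)))"
      by (intro continuous_map_from_subtopology continuous_map_compose_app[OF f(1)]
          continuous_map_compose_app[OF cont_crush] continuous_map_snd)
  qed (use cu \<gamma>(2) in auto)
  have KD: "K (t, x) = \<gamma> (t, x)" if "x \<in> D" for t x
    using that D_sub u_zero[of x] by (auto simp: K_def crush_D)
  have ck: "continuous_map M Y (\<lambda>x. K (r, x))" if "r = 0 \<or> r = 1" for r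
    using that by (auto intro!: continuous_map_compose_pair[OF cK])
  have "homotopic_with P M Y f (\<lambda>x. K (0, x))"
    unfolding P_def using f KD \<gamma>(2) by (intro homotopic_agree_on_boundary[OF Y] ck) auto
  moreover have "homotopic_with P M Y (\<lambda>x. K (0, x)) (\<lambda>x. K (1, x))"
    by (rule homotopic_withI[OF cK _ _ _ P_cong]) (use KD \<gamma>D in \<open>auto simp: P_def\<close>)
  moreover have "homotopic_with P M Y (\<lambda>x. K (1, x)) g"
    unfolding P_def using g KD \<gamma>(3) \<gamma>D[of 1] by (intro homotopic_agree_on_boundary[OF Y] ck) auto
  ultimately show ?thesis
    using homotopic_with_trans by blast
qed

end

section \<open>Proper homotopy equivalence of interiors\<close>

text \<open>A compact subset of \<open>T\<close> has its full preimage in \<open>X\<close> inside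
  \<open>S\<close>, and this preimage is closed in the compact space \<open>X\<close>. The
  equivalence between \<open>f x \<in> T\<close> and \<open>x \<in> S\<close> is what prevents
  points from escaping.\<close>

lemma proper_continuous_map_restrict:
  assumes "compact_space X" "Hausdorff_space Y" and f: "continuous_map X Y f"
    and ST: "\<And>x. x \<in> topspace X \<Longrightarrow> f x \<in> T \<longleftrightarrow> x \<in> S"
  shows "proper_continuous_map (subtopology X S) (subtopology Y T) f"
  unfolding proper_continuous_map_def
proof (intro conjI allI impI)
  show "continuous_map (subtopology X S) (subtopology Y T) f"
    using f ST by (auto simp: continuous_map_in_subtopology continuous_map_from_subtopology)
next
  fix K assume "compactin (subtopology Y T) K"
  then have K: "compactin Y K" "K \<subseteq> T"
    by (auto simp: compactin_subtopology)
  then have "closedin Y K"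
    using assms(2) compactin_imp_closedin by blast
  then have "closedin X {x \<in> topspace X. f x \<in> K}"
    by (rule closedin_continuous_map_preimage[OF f])
  then have "compactin X {x \<in> topspace X. f x \<in> K}"
    using assms(1) closedin_compact_space by blast
  moreover have "{x \<in> topspace (subtopology X S). f x \<in> K} = {x \<in> topspace X. f x \<in> K}"
    using ST K(2) by auto
  ultimately show "compactin (subtopology X S) {x \<in> topspace (subtopology X S). f x \<in> K}"
    using ST K(2) by (auto simp: compactin_subtopology)
qed

locale two_boundary_pairs =
  X: boundary_pair M D u h p + Y: boundary_pair M' D' u' h' p'
  for M :: "'a topology" and D u h p and M' :: "'b topology" and D' u' h' p' +
  assumes compact_M: "compact_space M" and compact_M': "compact_space M'"
    and Haus_M: "Hausdorff_space M" and Haus_M': "Hausdorff_space M'"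
    and contr_M: "contractible_space M" and contr_M': "contractible_space M'"
    and ne_M: "topspace M \<noteq> {}" and ne_M': "topspace M' \<noteq> {}"
begin

lemma swap: "two_boundary_pairs M' D' u' h' p' M D u h p"
  by (intro two_boundary_pairs.intro two_boundary_pairs_axioms.intro X.boundary_pair_axioms
      Y.boundary_pair_axioms compact_M compact_M' Haus_M Haus_M' contr_M contr_M' ne_M ne_M')

text \<open>An extension \<open>F\<close> may hit \<open>D'\<close> at points outside
  \<open>D\<close>. Pushing \<open>F x\<close> inwards for time \<open>u x\<close> removes these
  hits and changes nothing on \<open>D\<close>, where \<open>u\<close> vanishes.\<close>

lemma proper_map_of_boundary_map:
  assumes f: "continuous_map (subtopology M D) (subtopology M' D') f"
  shows "\<exists>F. continuous_map M M' F \<and> (\<forall>x \<in> D. F x = f x) \<and> (\<forall>x \<in> topspace M. F x \<in> D' \<longleftrightarrow> x \<in> D)"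
proof -
  obtain F where F: "continuous_map M M' F" "\<And>x. x \<in> D \<Longrightarrow> F x = f x"
    using X.extension_contractible[OF contr_M' ne_M'] f by (metis continuous_map_in_subtopology)
  have fD: "f x \<in> D'" if "x \<in> D" for x
    using continuous_map_in[OF f, of x] that X.D_sub by auto
  show ?thesis
  proof (intro exI conjI ballI)
    show "continuous_map M M' (\<lambda>x. p' (u x, F x))"
      by (rule continuous_map_compose_pair[OF Y.cont_p X.cont_u F(1)])
    show F': "p' (u x, F x) = f x" if "x \<in> D" for x
    proof -
      have "x \<in> topspace M" using that X.D_sub by auto
      then show ?thesis
        using that X.u_zero[of x] Y.p_0[of "F x"] F(2)[OF that] continuous_map_in[OF F(1), of x] by simp
    qed
    show "p' (u x, F x) \<in> D' \<longleftrightarrow> x \<in> D" if x: "x \<in> topspace M" for x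
    proof (cases "x \<in> D")
      case False
      then have "0 < u x"
        using x X.u_zero X.u_bounds(1)[of x] by (metis less_eq_real_def)
      then show ?thesis
        using False Y.p_pos[OF continuous_map_in[OF F(1) x]] X.u_bounds(2)[OF x] by auto
    qed (use F' fD in auto)
  qed
qed

text \<open>The factor \<open>t (1 - t) u x\<close> pushes the intermediate stages off \<open>D'\<close> away from \<open>D\<close>, while fixing
  both ends and the homotopy over \<open>D\<close>.\<close>

lemma properly_homotopic_interior:
  assumes f: "\<And>x. x \<in> topspace M \<Longrightarrow> f x \<in> D' \<longleftrightarrow> x \<in> D"
    and g: "\<And>x. x \<in> topspace M \<Longrightarrow> g x \<in> D' \<longleftrightarrow> x \<in> D"
    and hom: "homotopic_with (\<lambda>k. k ` D \<subseteq> D') M M' f g"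
  shows "properly_homotopic (subtopology M (- D)) (subtopology M' (- D')) f g"
proof -
  let ?I = "prod_topology unit_interval M"
  obtain k where k: "continuous_map ?I M' k" "\<And>x. k (0, x) = f x" "\<And>x. k (1, x) = g x"
      "\<And>t x. 0 \<le> t \<Longrightarrow> t \<le> 1 \<Longrightarrow> x \<in> D \<Longrightarrow> k (t, x) \<in> D'"
    using hom unfolding homotopic_with_def by (auto simp: image_subset_iff)
  define w where "w z = fst z * (1 - fst z) * u (snd z)" for z :: "real \<times> 'a"
  define K where "K z = p' (w z, k z)" for z
  have kM: "k (t, x) \<in> topspace M'" if "0 \<le> t" "t \<le> 1" "x \<in> topspace M" for t x
    using continuous_map_in[OF k(1), of "(t, x)"] that by simp
  have wb: "0 \<le> w (t, x)" "w (t, x) \<le> 1" if "0 \<le> t" "t \<le> 1" "x \<in> topspace M" for t x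
    using that X.u_bounds[OF that(3)] by (auto simp: w_def intro!: mult_le_one mult_nonneg_nonneg)
  have "continuous_map ?I euclideanreal fst"
    using continuous_map_fst[of unit_interval M] by (simp add: continuous_map_in_subtopology)
  then have "continuous_map ?I euclideanreal w"
    unfolding w_def
    by (intro continuous_map_real_mult continuous_map_diff
        continuous_map_compose_app[OF X.cont_u_real continuous_map_snd]) auto
  then have "continuous_map ?I unit_interval w"
    unfolding continuous_map_unit_interval using wb by auto
  then have cK: "continuous_map ?I M' K"
    unfolding K_def using continuous_map_compose_pair[OF Y.cont_p _ k(1)] by simp
  have KD: "K (t, x) \<in> D' \<longleftrightarrow> x \<in> D" if t: "0 \<le> t" "t \<le> 1" and x: "x \<in> topspace M" for t x
  proof (cases "x \<in> D \<or> t = 0 \<or> t = 1")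
    case True
    then have "w (t, x) = 0"
      using X.u_zero[OF x] by (auto simp: w_def)
    then have "K (t, x) = k (t, x)"
      unfolding K_def using Y.p_0 kM t x by auto
    then show ?thesis
      using True k(2-4) f[OF x] g[OF x] t by auto
  next
    case False
    then have "u x > 0" "t > 0" "1 - t > 0"
      using X.u_zero[OF x] X.u_bounds(1)[OF x] t by auto
    then have "w (t, x) > 0"
      by (simp add: w_def)
    then have "K (t, x) \<notin> D'"
      unfolding K_def using Y.p_pos kM wb t x by auto
    then show ?thesis
      using False by auto
  qed
  have "proper_continuous_map (subtopology ?I (UNIV \<times> - D)) (subtopology M' (- D')) K"
  proof (rule proper_continuous_map_restrict[OF _ Haus_M' cK])
    show "compact_space ?I"
      using compact_M compact_Icc[of "0::real" 1] by (simp add: compact_space_prod_topology compact_space_subtopology)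
  qed (use KD in auto)
  moreover have "subtopology ?I (UNIV \<times> - D) = prod_topology unit_interval (subtopology M (- D))"
    by (simp add: subtopology_Times)
  moreover have "K (0, x) = f x" "K (1, x) = g x" if "x \<in> topspace M" for x
    using that kM[of 0 x] kM[of 1 x] Y.p_0 k(2,3) by (auto simp: K_def w_def)
  ultimately show ?thesis
    unfolding properly_homotopic_def by (intro exI[of _ K]) auto
qed

end

text \<open>On \<open>D\<close> the composite is \<open>g \<circ> f\<close>, so the given boundary
  homotopy to the identity extends over the contractible space \<open>M\<close> and can be made
  proper on the complement of \<open>D\<close>.\<close>

lemma (in two_boundary_pairs) composite_properly_homotopic_id:
  assumes F: "continuous_map M M' F" "\<forall>x \<in> D. F x = f x" "\<forall>x \<in> topspace M. F x \<in> D' \<longleftrightarrow> x \<in> D"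
    and G: "continuous_map M' M G" "\<forall>x \<in> D'. G x = g x" "\<forall>x \<in> topspace M'. G x \<in> D \<longleftrightarrow> x \<in> D'"
    and f: "continuous_map (subtopology M D) (subtopology M' D') f"
    and hom: "homotopic_with (\<lambda>_. True) (subtopology M D) (subtopology M D) (g \<circ> f) id"
  shows "properly_homotopic (subtopology M (- D)) (subtopology M (- D)) (G \<circ> F) id"
proof -
  have XX: "two_boundary_pairs M D u h p M D u h p"
    by (intro two_boundary_pairs.intro two_boundary_pairs_axioms.intro X.boundary_pair_axioms
        compact_M Haus_M contr_M ne_M)
  have fD: "f x \<in> D'" if "x \<in> D" for x
    using continuous_map_in[OF f, of x] that X.D_sub by auto
  have "homotopic_with (\<lambda>_. True) (subtopology M D) (subtopology M D) (G \<circ> F) id"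
    by (rule homotopic_with_eq[OF hom]) (use F(2) G(2) fD in auto)
  moreover have "F x \<in> topspace M'" if "x \<in> topspace M" for x
    using continuous_map_in[OF F(1) that] .
  then have GF: "(G \<circ> F) x \<in> D \<longleftrightarrow> x \<in> D" if "x \<in> topspace M" for x
    using F(3) G(3) that by simp
  ultimately have "homotopic_with (\<lambda>k. k ` D \<subseteq> D) M M (G \<circ> F) id"
    using X.D_sub
    by (intro X.homotopic_of_boundary_homotopy contr_M continuous_map_compose[OF F(1) G(1)]) auto
  with GF show ?thesis
    by (intro two_boundary_pairs.properly_homotopic_interior[OF XX]) auto
qed

lemma (in two_boundary_pairs) properly_homotopy_equivalent_interiors:
  assumes "subtopology M D homotopy_equivalent_space subtopology M' D'"
  shows "properly_homotopy_equivalent_space (subtopology M (- D)) (subtopology M' (- D'))"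
proof -
  obtain f g where f: "continuous_map (subtopology M D) (subtopology M' D') f"
    and g: "continuous_map (subtopology M' D') (subtopology M D) g"
    and gf: "homotopic_with (\<lambda>_. True) (subtopology M D) (subtopology M D) (g \<circ> f) id"
    and fg: "homotopic_with (\<lambda>_. True) (subtopology M' D') (subtopology M' D') (f \<circ> g) id"
    using assms unfolding homotopy_equivalent_space_def by blast
  obtain F where F: "continuous_map M M' F" "\<forall>x \<in> D. F x = f x" "\<forall>x \<in> topspace M. F x \<in> D' \<longleftrightarrow> x \<in> D"
    using proper_map_of_boundary_map[OF f] by blast
  obtain G where G: "continuous_map M' M G" "\<forall>x \<in> D'. G x = g x" "\<forall>x \<in> topspace M'. G x \<in> D \<longleftrightarrow> x \<in> D'"
    using two_boundary_pairs.proper_map_of_boundary_map[OF swap g] by blast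
  have "proper_continuous_map (subtopology M (- D)) (subtopology M' (- D')) F"
    using F(3) by (intro proper_continuous_map_restrict[OF compact_M Haus_M' F(1)]) auto
  moreover have "proper_continuous_map (subtopology M' (- D')) (subtopology M (- D)) G"
    using G(3) by (intro proper_continuous_map_restrict[OF compact_M' Haus_M G(1)]) auto
  ultimately show ?thesis
    unfolding properly_homotopy_equivalent_space_def
    using composite_properly_homotopic_id[OF F G f gf] two_boundary_pairs.composite_properly_homotopic_id[OF swap G F g fg]
    by blast
qed

section \<open>Homotopy equivalences\<close>

abbreviation homotopic :: "'a topology \<Rightarrow> 'b topology \<Rightarrow> ('a \<Rightarrow> 'b) \<Rightarrow> ('a \<Rightarrow> 'b) \<Rightarrow> bool" where
  "homotopic \<equiv> homotopic_with (\<lambda>_. True)"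

lemma homotopic_compose_left:
  "homotopic X Y f g \<Longrightarrow> continuous_map Y Z h \<Longrightarrow> homotopic X Z (h \<circ> f) (h \<circ> g)"
  by (rule homotopic_with_compose_continuous_map_left) auto

lemma homotopic_compose_right:
  "homotopic Y Z f g \<Longrightarrow> continuous_map X Y h \<Longrightarrow> homotopic X Z (f \<circ> h) (g \<circ> h)"
  by (rule homotopic_with_compose_continuous_map_right) auto

lemma homotopic_sym: "homotopic X Y f g \<Longrightarrow> homotopic X Y g f"
  by (rule homotopic_with_symD)

lemma homotopic_trans: "homotopic X Y f g \<Longrightarrow> homotopic X Y g h \<Longrightarrow> homotopic X Y f h"
  by (rule homotopic_with_trans)

text \<open>As in a category, left and right inverses agree: \<open>l\<close> is homotopic to
  \<open>l \<circ> g \<circ> r\<close>, hence to \<open>r\<close>.\<close>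

lemma homotopy_equivalence_map_left_right:
  assumes g: "continuous_map Y Z g" and r: "continuous_map Z Y r" and l: "continuous_map Z Y l"
    and gr: "homotopic Z Z (g \<circ> r) id" and lg: "homotopic Y Y (l \<circ> g) id"
  shows "homotopy_equivalence_map Y Z g"
proof -
  have "homotopic Z Y (l \<circ> (g \<circ> r)) (l \<circ> id)"
    by (rule homotopic_compose_left[OF gr l])
  moreover have "homotopic Z Y ((l \<circ> g) \<circ> r) (id \<circ> r)"
    by (rule homotopic_compose_right[OF lg r])
  ultimately have "homotopic Z Y r l"
    by (metis comp_assoc comp_id homotopic_sym homotopic_trans id_comp)
  then have "homotopic Y Y (r \<circ> g) id"
    using homotopic_compose_right[OF _ g] lg homotopic_trans by blast
  with g r gr show ?thesis
    unfolding homotopy_equivalence_map_def by blast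
qed

lemma homotopy_equivalence_map_compose:
  assumes "homotopy_equivalence_map X Y f" "homotopy_equivalence_map Y Z g"
  shows "homotopy_equivalence_map X Z (g \<circ> f)"
proof -
  obtain f' where f: "continuous_map X Y f" "continuous_map Y X f'" "homotopic X X (f' \<circ> f) id" "homotopic Y Y (f \<circ> f') id"
    using assms(1) unfolding homotopy_equivalence_map_def by blast
  obtain g' where g: "continuous_map Y Z g" "continuous_map Z Y g'" "homotopic Y Y (g' \<circ> g) id" "homotopic Z Z (g \<circ> g') id"
    using assms(2) unfolding homotopy_equivalence_map_def by blast
  have "homotopic X X (f' \<circ> ((g' \<circ> g) \<circ> f)) (f' \<circ> (id \<circ> f))"
    by (rule homotopic_compose_left[OF homotopic_compose_right[OF g(3) f(1)] f(2)])
  then have "homotopic X X ((f' \<circ> g') \<circ> (g \<circ> f)) (f' \<circ> f)"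
    by (simp add: comp_assoc)
  then have 1: "homotopic X X ((f' \<circ> g') \<circ> (g \<circ> f)) id"
    using f(3) by (rule homotopic_trans)
  have "homotopic Z Z (g \<circ> ((f \<circ> f') \<circ> g')) (g \<circ> (id \<circ> g'))"
    by (rule homotopic_compose_left[OF homotopic_compose_right[OF f(4) g(2)] g(1)])
  then have "homotopic Z Z ((g \<circ> f) \<circ> (f' \<circ> g')) (g \<circ> g')"
    by (simp add: comp_assoc)
  then have 2: "homotopic Z Z ((g \<circ> f) \<circ> (f' \<circ> g')) id"
    using g(4) by (rule homotopic_trans)
  show ?thesis
    unfolding homotopy_equivalence_map_def
    using 1 2 continuous_map_compose[OF f(1) g(1)] continuous_map_compose[OF g(2) f(2)] by blast
qed

text \<open>If \<open>k\<close> is an inverse of \<open>g \<circ> f\<close>, then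
  \<open>k \<circ> g\<close> is one of \<open>f\<close>; for \<open>f \<circ> k \<circ> g\<close>
  this is seen after inserting \<open>g' \<circ> g\<close> in front.\<close>

lemma homotopy_equivalence_map_left_cancel:
  assumes f: "continuous_map X Y f" and g: "homotopy_equivalence_map Y Z g"
    and gf: "homotopy_equivalence_map X Z (g \<circ> f)"
  shows "homotopy_equivalence_map X Y f"
proof -
  obtain g' where g: "continuous_map Y Z g" "continuous_map Z Y g'" "homotopic Y Y (g' \<circ> g) id"
    using g unfolding homotopy_equivalence_map_def by blast
  obtain k where k: "continuous_map Z X k" "homotopic X X (k \<circ> (g \<circ> f)) id" "homotopic Z Z ((g \<circ> f) \<circ> k) id"
    using gf unfolding homotopy_equivalence_map_def by blast
  have "homotopic Y Y ((g' \<circ> g) \<circ> (f \<circ> k \<circ> g)) (id \<circ> (f \<circ> k \<circ> g))"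
    by (rule homotopic_compose_right[OF g(3) continuous_map_compose[OF g(1) continuous_map_compose[OF k(1) f]]])
  moreover have "homotopic Y Y (g' \<circ> (((g \<circ> f) \<circ> k) \<circ> g)) (g' \<circ> (id \<circ> g))"
    by (rule homotopic_compose_left[OF homotopic_compose_right[OF k(3) g(1)] g(2)])
  ultimately have "homotopic Y Y (f \<circ> (k \<circ> g)) (g' \<circ> g)"
    by (metis comp_assoc homotopic_sym homotopic_trans id_comp)
  then have 1: "homotopic Y Y (f \<circ> (k \<circ> g)) id"
    using g(3) homotopic_trans by blast
  have 2: "homotopic X X ((k \<circ> g) \<circ> f) id"
    using k(2) by (simp add: comp_assoc)
  show ?thesis
    unfolding homotopy_equivalence_map_def
    using f continuous_map_compose[OF g(1) k(1)] 1 2 by blast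
qed

text \<open>The inverse of \<open>g \<circ> f\<close> gives \<open>g\<close> a right inverse, and
  the inverse of \<open>h \<circ> g\<close> gives it a left inverse.\<close>

lemma homotopy_equivalence_map_two_of_six:
  assumes f: "continuous_map A B f" and g: "continuous_map B C g" and h: "continuous_map C D h"
    and gf: "homotopy_equivalence_map A C (g \<circ> f)" and hg: "homotopy_equivalence_map B D (h \<circ> g)"
  shows "homotopy_equivalence_map B C g"
proof -
  obtain k where k: "continuous_map C A k" "homotopic C C ((g \<circ> f) \<circ> k) id"
    using gf unfolding homotopy_equivalence_map_def by blast
  obtain l where l: "continuous_map D B l" "homotopic B B (l \<circ> (h \<circ> g)) id"
    using hg unfolding homotopy_equivalence_map_def by blast
  show ?thesis
    using k(2) l(2)
    by (intro homotopy_equivalence_map_left_right[OF g, of "f \<circ> k" "l \<circ> h"]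
        continuous_map_compose[OF k(1) f] continuous_map_compose[OF h l(1)])
      (simp_all add: comp_assoc)
qed

lemma homeomorphic_imp_homotopy_equivalence_map:
  assumes "homeomorphic_maps X Y f g"
  shows "homotopy_equivalence_map X Y f"
  unfolding homotopy_equivalence_map_def
proof (intro conjI exI)
  show cf: "continuous_map X Y f" and cg: "continuous_map Y X g"
    using homeomorphic_mapsD[OF assms] by auto
  show "homotopic X X (g \<circ> f) id" "homotopic Y Y (f \<circ> g) id"
    using homeomorphic_mapsD[OF assms]
    by (auto intro!: homotopic_with_equal continuous_map_compose[OF cf cg] continuous_map_compose[OF cg cf])
qed

section \<open>Collared ends\<close>

text \<open>\<open>u\<close> measures the distance to infinity: it is positive, small values lie far
  out, and \<open>compact_core\<close> says that nothing else is noncompact. Where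
  \<open>u < 1\<close>, the pair of \<open>\<pi>\<close> and \<open>u\<close> is inverse to the
  collar \<open>a\<close>.\<close>

locale collared_end =
  fixes Z :: "'a topology" and Y :: "'b topology" and a :: "'b \<times> real \<Rightarrow> 'a"
    and u :: "'a \<Rightarrow> real" and \<pi> :: "'a \<Rightarrow> 'b"
  assumes cont_a: "continuous_map (prod_topology Y (top_of_set {0<..<1})) Z a"
    and cont_u: "continuous_map Z euclideanreal u"
    and u_pos: "z \<in> topspace Z \<Longrightarrow> 0 < u z"
    and cont_\<pi>: "continuous_map (subtopology Z {z \<in> topspace Z. u z < 1}) Y \<pi>"
    and ua: "y \<in> topspace Y \<Longrightarrow> 0 < t \<Longrightarrow> t < 1 \<Longrightarrow> u (a (y, t)) = t"
    and \<pi>a: "y \<in> topspace Y \<Longrightarrow> 0 < t \<Longrightarrow> t < 1 \<Longrightarrow> \<pi> (a (y, t)) = y"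
    and a\<pi>u: "z \<in> topspace Z \<Longrightarrow> u z < 1 \<Longrightarrow> a (\<pi> z, u z) = z"
    and compact_core: "0 < t \<Longrightarrow> compactin Z {z \<in> topspace Z. t \<le> u z}"
begin

definition tail :: "real \<Rightarrow> 'a topology" where
  "tail t = subtopology Z {z \<in> topspace Z. u z \<le> t}"

lemma topspace_tail: "topspace (tail t) = {z \<in> topspace Z. u z \<le> t}"
  by (auto simp: tail_def)

lemma \<pi>_in: "z \<in> topspace Z \<Longrightarrow> u z < 1 \<Longrightarrow> \<pi> z \<in> topspace Y"
  using continuous_map_in[OF cont_\<pi>, of z] by auto

lemma a_in: "y \<in> topspace Y \<Longrightarrow> 0 < t \<Longrightarrow> t < 1 \<Longrightarrow> a (y, t) \<in> topspace Z"
  using continuous_map_in[OF cont_a, of "(y, t)"] by auto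

lemma cont_\<pi>_sub:
  assumes "\<And>z. z \<in> S \<Longrightarrow> z \<in> topspace Z \<Longrightarrow> u z < 1"
  shows "continuous_map (subtopology Z S) Y \<pi>"
proof (subst subtopology_restrict[of Z S, symmetric])
  show "continuous_map (subtopology Z (topspace Z \<inter> S)) Y \<pi>"
    using assms by (intro continuous_map_from_subtopology_mono[OF cont_\<pi>]) auto
qed

lemma a_slice: "0 < t \<Longrightarrow> t < 1 \<Longrightarrow> continuous_map Y Z (\<lambda>y. a (y, t))"
  by (rule continuous_map_compose_pair[OF cont_a]) auto

lemma cont_a_compose:
  assumes "continuous_map X Y f" "continuous_map X euclideanreal t"
    and "\<And>x. x \<in> topspace X \<Longrightarrow> 0 < t x \<and> t x < 1"
  shows "continuous_map X Z (\<lambda>x. a (f x, t x))"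
  using assms by (intro continuous_map_compose_pair[OF cont_a]) (auto simp: continuous_map_in_subtopology)

text \<open>On a nonempty compact set \<open>u\<close> attains a positive minimum, so a sufficiently
  far tail misses the set. Two collars of one space can be nested only through this fact.\<close>

lemma exists_tail_avoiding:
  assumes "compactin Z K"
  obtains t where "0 < t" "t < 1" "\<And>z. z \<in> K \<Longrightarrow> t < u z"
proof (cases "K = {}")
  case True
  then show thesis using that[of "1/2"] by auto
next
  case False
  have "compact (u ` K)"
    using image_compactin[OF assms cont_u] by simp
  then obtain z where z: "z \<in> K" "\<And>w. w \<in> K \<Longrightarrow> u z \<le> u w"
    using compact_attains_inf[of "u ` K"] False by auto
  have "0 < u z"
    using u_pos z(1) compactin_subset_topspace[OF assms] by auto
  then show thesis
    using z by (intro that[of "min (1/2) (u z / 2)"]) force+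
qed

text \<open>Points slide along their collar lines. The intermediate levels are convex combinations
  of \<open>s\<close> and \<open>u z\<close>, hence positive and at most \<open>t\<close>.\<close>

lemma homotopic_tail:
  assumes "0 < s" "s \<le> t" "t < 1"
  shows "homotopic (tail t) (tail t) (\<lambda>z. a (\<pi> z, s)) id"
proof (rule homotopic_withI[where h = "\<lambda>x. a (\<pi> (snd x), (1 - fst x) * s + fst x * u (snd x))"])
  let ?X = "prod_topology unit_interval (tail t)"
  have c1: "continuous_map ?X euclideanreal fst"
    using continuous_map_fst[of unit_interval "tail t"] by (simp add: continuous_map_in_subtopology)
  have "continuous_map (tail t) Y \<pi>"
    unfolding tail_def using assms by (intro cont_\<pi>_sub) auto
  then have c2: "continuous_map ?X Y (\<lambda>x. \<pi> (snd x))"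
    by (rule continuous_map_compose_app[OF _ continuous_map_snd])
  have "continuous_map (tail t) euclideanreal u"
    unfolding tail_def by (rule continuous_map_from_subtopology[OF cont_u])
  then have c3: "continuous_map ?X euclideanreal (\<lambda>x. u (snd x))"
    by (rule continuous_map_compose_app[OF _ continuous_map_snd])
  have b: "0 < (1 - r) * s + r * u z" "(1 - r) * s + r * u z \<le> t"
    if "0 \<le> r" "r \<le> 1" "z \<in> topspace (tail t)" for r z
  proof -
    have uz: "0 < u z" "u z \<le> t" using that u_pos by (auto simp: topspace_tail)
    have "(1 - r) * s + r * u z \<le> (1 - r) * t + r * t"
      using that uz assms by (intro add_mono mult_left_mono) auto
    then show "(1 - r) * s + r * u z \<le> t"
      by (simp add: algebra_simps)
    show "0 < (1 - r) * s + r * u z"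
      using that uz assms by (cases "r = 0") (auto intro!: add_nonneg_pos)
  qed
  have "continuous_map ?X Z (\<lambda>x. a (\<pi> (snd x), (1 - fst x) * s + fst x * u (snd x)))"
    using b assms by (intro cont_a_compose c2 continuous_map_add continuous_map_real_mult
        continuous_map_diff c1 c3) force+
  moreover have "u (a (\<pi> z, (1 - r) * s + r * u z)) \<le> t" "a (\<pi> z, (1 - r) * s + r * u z) \<in> topspace Z"
    if "0 \<le> r" "r \<le> 1" "z \<in> topspace (tail t)" for r z
    using b[OF that] that assms ua[OF \<pi>_in] a_in[OF \<pi>_in] by (auto simp: topspace_tail)
  ultimately show "continuous_map ?X (tail t) (\<lambda>x. a (\<pi> (snd x), (1 - fst x) * s + fst x * u (snd x)))"
    unfolding tail_def[of t] continuous_map_in_subtopology by (auto simp: tail_def)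
qed (use assms a\<pi>u in \<open>auto simp: topspace_tail\<close>)

lemma cont_a_tail:
  assumes "0 < s" "s \<le> t" "t < 1"
  shows "continuous_map Y (tail t) (\<lambda>y. a (y, s))"
  using a_slice[of s] ua[of _ s] a_in[of _ s] assms by (auto simp: tail_def continuous_map_in_subtopology)

lemma cont_a\<pi>_tail:
  assumes "0 < s" "s \<le> t" "t < 1"
  shows "continuous_map (tail t) (tail s) (\<lambda>z. a (\<pi> z, s))"
proof (rule continuous_map_compose_app[OF cont_a_tail])
  show "continuous_map (tail t) Y \<pi>"
    unfolding tail_def using assms by (intro cont_\<pi>_sub) auto
qed (use assms in auto)

lemma homotopy_equivalence_map_slice:
  assumes "0 < t" "t < 1"
  shows "homotopy_equivalence_map Y (tail t) (\<lambda>y. a (y, t))"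
  unfolding homotopy_equivalence_map_def
proof (intro conjI exI)
  show "continuous_map (tail t) Y \<pi>"
    unfolding tail_def using assms by (intro cont_\<pi>_sub) auto
  show "homotopic Y Y (\<pi> \<circ> (\<lambda>y. a (y, t))) id"
    using assms \<pi>a by (intro homotopic_sym[OF homotopic_with_equal]) auto
  show "homotopic (tail t) (tail t) ((\<lambda>y. a (y, t)) \<circ> \<pi>) id"
    using homotopic_tail[of t t] assms by (simp add: o_def)
qed (use assms in \<open>auto intro: cont_a_tail\<close>)

lemma homotopy_equivalence_map_tails:
  assumes "0 < s" "s \<le> t" "t < 1"
  shows "homotopy_equivalence_map (tail s) (tail t) id"
  unfolding homotopy_equivalence_map_def
proof (intro conjI exI)
  show "continuous_map (tail s) (tail t) id"
    using assms by (auto simp: tail_def continuous_map_in_subtopology continuous_map_from_subtopology)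
  show "homotopic (tail s) (tail s) ((\<lambda>z. a (\<pi> z, s)) \<circ> id) id"
    "homotopic (tail t) (tail t) (id \<circ> (\<lambda>z. a (\<pi> z, s))) id"
    using homotopic_tail[of s s] homotopic_tail[of s t] assms by (simp_all add: o_def)
qed (rule cont_a\<pi>_tail[OF assms])

end

section \<open>The region between two collared ends\<close>

text \<open>A germ sees only the trace of the subspace on a neighbourhood of the point. This lets a
  region bounded by several walls be treated one wall at a time.\<close>

lemma germ_homeomorphic_subspaces:
  assumes U: "openin Z U" "p \<in> U" and "U \<inter> S = U \<inter> T" "p \<in> S" "p \<in> topspace Z"
  shows "germ_homeomorphic (subtopology Z S) p (subtopology Z T) p"
proof -
  have "openin (subtopology Z S) (U \<inter> S)" "openin (subtopology Z T) (U \<inter> T)"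
    using U(1) openin_subtopology_Int by blast+
  then have "germ_homeomorphic (subtopology (subtopology Z S) (U \<inter> S)) p (subtopology Z S) p"
    "germ_homeomorphic (subtopology (subtopology Z T) (U \<inter> T)) p (subtopology Z T) p"
    using assms by (auto intro!: germ_homeomorphic_open_subtopology)
  moreover have "subtopology (subtopology Z S) (U \<inter> S) = subtopology (subtopology Z T) (U \<inter> T)"
  proof -
    have "S \<inter> (U \<inter> S) = T \<inter> (U \<inter> T)"
      using assms(3) by blast
    then show ?thesis
      by (simp add: subtopology_subtopology)
  qed
  ultimately show ?thesis
    using germ_homeomorphic_sym germ_homeomorphic_trans by metis
qed

lemma openin_half_line_initial_segment: "openin (top_of_set {0::real..}) {0..<c}"
  unfolding openin_open by (rule exI[of _ "{..<c}"]) auto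

context collared_end
begin

text \<open>A level set is two-sided; \<open>\<sigma> = 1\<close> gives the side above it and \<open>\<sigma> = - 1\<close> the side below.\<close>

lemma level_germ:
  assumes t: "0 < t" "t < 1" and c: "c = (if \<sigma> = 1 then 1 - t else t)" and \<sigma>: "\<sigma> = 1 \<or> \<sigma> = - 1"
    and z: "z \<in> topspace Z" "u z = t"
  shows "germ_homeomorphic (subtopology Z {w \<in> topspace Z. 0 \<le> \<sigma> * (u w - t) \<and> u w < 1}) z
           (prod_topology Y (top_of_set {0::real..})) (\<pi> z, 0)"
proof -
  let ?S = "{w \<in> topspace Z. 0 \<le> \<sigma> * (u w - t) \<and> u w < 1}"
  let ?P = "prod_topology Y (top_of_set {0::real..})"
  \<comment> \<open>\<open>c\<close> is the room on the chosen side of the level: up to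
    \<open>u = 1\<close> above it, down to \<open>u = 0\<close> below it.\<close>
  let ?V = "topspace Y \<times> {0..<c}"
  let ?f = "\<lambda>w. (\<pi> w, \<sigma> * (u w - t))" and ?g = "\<lambda>(y, r). a (y, t + \<sigma> * r)"
  have PV: "subtopology ?P ?V = prod_topology Y (top_of_set {0..<c})"
    by (simp add: subtopology_Times subtopology_subtopology Int_absorb1 subset_iff)
  have rng: "0 < t + \<sigma> * r" "t + \<sigma> * r < 1" if "0 \<le> r" "r < c" for r
    using that t c \<sigma> by (auto split: if_splits)
  have hm: "homeomorphic_maps (subtopology Z ?S) (subtopology ?P ?V) ?f ?g"
    unfolding homeomorphic_maps_def PV
  proof (intro conjI)
    have "continuous_map (subtopology Z ?S) euclideanreal (\<lambda>w. \<sigma> * (u w - t))"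
      by (intro continuous_map_real_mult continuous_map_diff continuous_map_from_subtopology[OF cont_u]) auto
    moreover have "continuous_map (subtopology Z ?S) Y \<pi>"
      by (rule cont_\<pi>_sub) auto
    moreover have "\<sigma> * (u w - t) < c" if "w \<in> ?S" for w
      using that c \<sigma> u_pos[of w] by (auto split: if_splits)
    ultimately show "continuous_map (subtopology Z ?S) (prod_topology Y (top_of_set {0..<c})) ?f"
      by (auto simp: continuous_map_paired continuous_map_in_subtopology)
    let ?Q = "prod_topology Y (top_of_set {0..<c})"
    have "continuous_map ?Q euclideanreal snd"
      using continuous_map_snd[of Y "top_of_set {0..<c}"] by (simp add: continuous_map_in_subtopology)
    then have "continuous_map ?Q Z (\<lambda>x. a (fst x, t + \<sigma> * snd x))"
      using rng by (intro cont_a_compose continuous_map_fst continuous_map_add continuous_map_real_mult) auto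
    moreover have "0 \<le> \<sigma> * (u (a (y, t + \<sigma> * r)) - t)" "u (a (y, t + \<sigma> * r)) < 1"
      if "y \<in> topspace Y" "0 \<le> r" "r < c" for y r
      using ua[OF that(1) rng[OF that(2,3)]] rng[OF that(2,3)] \<sigma> that by auto
    ultimately show "continuous_map ?Q (subtopology Z ?S) ?g"
      using a_in rng by (auto simp: continuous_map_in_subtopology case_prod_unfold)
    have \<sigma>\<sigma>: "\<sigma> * (\<sigma> * r) = r" for r
      using \<sigma> by auto
    show "\<forall>x\<in>topspace (subtopology Z ?S). ?g (?f x) = x"
      using a\<pi>u by (auto simp: \<sigma>\<sigma>)
    show "\<forall>y\<in>topspace ?Q. ?f (?g y) = y"
      using \<pi>a ua rng by (auto simp: \<sigma>\<sigma>)
  qed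
  have "openin ?P ?V"
    by (simp add: openin_prod_Times_iff openin_half_line_initial_segment)
  moreover have "z \<in> topspace (subtopology Z ?S)"
    using z t by simp
  ultimately have "germ_homeomorphic (subtopology Z ?S) z ?P (\<pi> z, \<sigma> * (u z - t))"
    by (rule germ_homeomorphic_open_embedding[OF hm])
  then show ?thesis
    unfolding z(2) diff_self mult_zero_right .
qed

lemma cont_a_level: "0 < t \<Longrightarrow> t < 1 \<Longrightarrow> (\<And>y. y \<in> topspace Y \<Longrightarrow> a (y, t) \<in> S) \<Longrightarrow>
    continuous_map Y (subtopology Z S) (\<lambda>y. a (y, t))"
  using a_slice by (auto simp: continuous_map_in_subtopology)

end

text \<open>\<open>st\<close> places the whole tail \<open>v \<le> s\<close> strictly beyond the
  level \<open>u = t\<close>, so the two levels are disjoint and no point of the region lies on both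
  walls.\<close>

locale two_ends =
  E: collared_end Z Y a u \<pi> + F: collared_end Z Y' b v \<rho>
  for Z :: "'a topology" and Y Y' :: "'c topology" and a u \<pi> b v \<rho> +
  fixes m :: nat and t s :: real
  assumes t: "0 < t" "t < 1" and s: "0 < s" "s < 1"
    and st: "\<And>z. z \<in> topspace Z \<Longrightarrow> v z \<le> s \<Longrightarrow> u z < t"
    and Haus: "Hausdorff_space Z" and second_countable: "second_countable Z"
    and germ_Z: "\<And>z. z \<in> topspace Z \<Longrightarrow> \<exists>q. germ_homeomorphic Z z (Euclidean_space (Suc m)) q"
    and closed_Y: "closed_manifold m Y" and closed_Y': "closed_manifold m Y'"
begin

definition band :: "'a topology" where
  "band = subtopology Z {z \<in> topspace Z. u z \<le> t \<and> s \<le> v z}"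

lemma topspace_band: "topspace band = {z \<in> topspace Z. u z \<le> t \<and> s \<le> v z}"
  by (auto simp: band_def)

lemma a_band: "y \<in> topspace Y \<Longrightarrow> a (y, t) \<in> topspace band"
  using E.a_in[of y t] E.ua[of y t] st[of "a (y, t)"] t by (force simp: topspace_band)

lemma b_band: "y \<in> topspace Y' \<Longrightarrow> b (y, s) \<in> topspace band"
  using F.a_in[of y s] F.ua[of y s] st[of "b (y, s)"] s by (force simp: topspace_band)

lemma cont_a_band: "continuous_map Y band (\<lambda>y. a (y, t))"
  using E.cont_a_level[OF t, of "topspace band"] a_band unfolding band_def
  by (metis (no_types, lifting) band_def topspace_band)

lemma cont_b_band: "continuous_map Y' band (\<lambda>y. b (y, s))"
  using F.cont_a_level[OF s, of "topspace band"] b_band unfolding band_def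
  by (metis (no_types, lifting) band_def topspace_band)

text \<open>The condition \<open>s \<le> v z\<close> cuts off the far end of \<open>Z\<close>, and
  \<open>u z \<le> t\<close> is a closed condition on the compact core that remains.\<close>

lemma compact_band: "compact_space band"
proof -
  have "closedin Z {z \<in> topspace Z. u z \<in> {..t}}"
    by (rule closedin_continuous_map_preimage[OF E.cont_u]) auto
  then have "compactin Z ({z \<in> topspace Z. u z \<in> {..t}} \<inter> {z \<in> topspace Z. s \<le> v z})"
    using F.compact_core[OF s(1)] closed_Int_compactin by blast
  also have "{z \<in> topspace Z. u z \<in> {..t}} \<inter> {z \<in> topspace Z. s \<le> v z} = {z \<in> topspace Z. u z \<le> t \<and> s \<le> v z}"
    by auto
  finally show ?thesis
    by (simp add: band_def compact_space_subtopology)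
qed

text \<open>The tail \<open>u \<le> t\<close> is the region together with the tail
  \<open>v \<le> s\<close>. The latter is pushed back along the second collar onto its level, and
  stays inside the former meanwhile because of \<open>st\<close>.\<close>

lemma band_inclusion: "homotopy_equivalence_map band (E.tail t) id"
  unfolding homotopy_equivalence_map_def
proof (intro conjI exI)
  let ?T = "E.tail t"
  let ?X = "prod_topology unit_interval ?T"
  \<comment> \<open>Time 0 is the retraction to the level \<open>v = s\<close>, time 1 the identity;
    on that level the formula already gives the point itself.\<close>
  define k where "k x = (if v (snd x) \<le> s then b (\<rho> (snd x), (1 - fst x) * s + fst x * v (snd x)) else snd x)" for x
  have "continuous_map ?T euclideanreal v"
    unfolding E.tail_def by (rule continuous_map_from_subtopology[OF F.cont_u])
  then have cv: "continuous_map ?X euclideanreal (\<lambda>x. v (snd x))"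
    by (rule continuous_map_compose_app[OF _ continuous_map_snd])
  have c1: "continuous_map ?X euclideanreal fst"
    using continuous_map_fst[of unit_interval ?T] by (simp add: continuous_map_in_subtopology)
  have rng: "0 < (1 - r) * s + r * v z" "(1 - r) * s + r * v z \<le> s"
    if "0 \<le> r" "r \<le> 1" "z \<in> topspace Z" "v z \<le> s" for r z
  proof -
    have "(1 - r) * s + r * v z \<le> (1 - r) * s + r * s"
      using that by (intro add_mono mult_left_mono) auto
    then show "(1 - r) * s + r * v z \<le> s"
      by (simp add: algebra_simps)
    show "0 < (1 - r) * s + r * v z"
      using that s F.u_pos[of z] by (cases "r = 0") (auto intro!: add_nonneg_pos)
  qed
  have "continuous_map ?X Z k"
    unfolding k_def
  proof (rule continuous_map_cases_le[OF cv])
    let ?S = "subtopology ?X {x \<in> topspace ?X. v (snd x) \<le> s}"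
    have "continuous_map ?S Z snd"
      using continuous_map_from_subtopology[OF continuous_map_snd[of unit_interval ?T]]
      by (simp add: E.tail_def continuous_map_in_subtopology)
    then have "continuous_map ?S (subtopology Z {z \<in> topspace Z. v z < 1}) snd"
      using s by (auto simp: continuous_map_in_subtopology E.topspace_tail)
    then have "continuous_map ?S Y' (\<lambda>x. \<rho> (snd x))"
      by (rule continuous_map_compose_app[OF F.cont_\<pi>])
    then show "continuous_map ?S Z (\<lambda>x. b (\<rho> (snd x), (1 - fst x) * s + fst x * v (snd x)))"
      using rng s by (intro F.cont_a_compose continuous_map_add continuous_map_real_mult continuous_map_diff
          continuous_map_from_subtopology[OF c1] continuous_map_from_subtopology[OF cv])
        (force simp: E.topspace_tail)+
    show "continuous_map (subtopology ?X {x \<in> topspace ?X. s \<le> v (snd x)}) Z snd"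
      using continuous_map_from_subtopology[OF continuous_map_snd[of unit_interval ?T]]
      by (simp add: E.tail_def continuous_map_in_subtopology)
    show "b (\<rho> (snd x), (1 - fst x) * s + fst x * v (snd x)) = snd x"
      if "x \<in> topspace ?X" "v (snd x) = s" for x
      using that F.a\<pi>u[of "snd x"] s by (auto simp: E.topspace_tail algebra_simps)
  qed auto
  moreover have k_tail: "k (r, z) \<in> topspace ?T" if "0 \<le> r" "r \<le> 1" "z \<in> topspace ?T" for r z
  proof (cases "v z \<le> s")
    case True
    let ?w = "b (\<rho> z, (1 - r) * s + r * v z)"
    have z: "z \<in> topspace Z" using that by (simp add: E.topspace_tail)
    have \<rho>: "\<rho> z \<in> topspace Y'"
      using F.\<pi>_in z True s by auto
    have w: "?w \<in> topspace Z" "v ?w = (1 - r) * s + r * v z"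
      using F.a_in[OF \<rho>] F.ua[OF \<rho>] rng[OF that(1,2) z True] s by auto
    then show ?thesis
      using st[of ?w] rng(2)[OF that(1,2) z True] True by (auto simp: k_def E.topspace_tail)
  qed (use that in \<open>auto simp: k_def\<close>)
  ultimately have ck: "continuous_map ?X ?T k"
    unfolding E.tail_def continuous_map_in_subtopology by (auto simp: E.topspace_tail)
  show "continuous_map band ?T id"
    by (auto simp: band_def E.tail_def continuous_map_in_subtopology continuous_map_from_subtopology)
  let ?r = "\<lambda>z. k (0, z)"
  have vr: "s \<le> v (?r z)" if "z \<in> topspace Z" for z
    using that F.ua[OF F.\<pi>_in, of z s] s by (auto simp: k_def)
  have "continuous_map ?T ?T ?r"
    by (rule continuous_map_compose_pair[OF ck]) auto
  then show "continuous_map ?T band ?r"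
    using vr by (auto simp: band_def E.tail_def continuous_map_in_subtopology)
  have k1: "k (1, z) = z" if "z \<in> topspace Z" for z
    using F.a\<pi>u[of z] that s by (auto simp: k_def)
  have "homotopic ?T ?T ?r id"
    by (rule homotopic_withI[OF ck]) (use k1 in \<open>auto simp: E.topspace_tail\<close>)
  then show "homotopic ?T ?T (id \<circ> ?r) id"
    by simp
  have "?r z = z" if "z \<in> topspace band" for z
    using that F.a\<pi>u[of z] s by (auto simp: k_def topspace_band)
  then show "homotopic band band (?r \<circ> id) id"
    by (intro homotopic_sym[OF homotopic_with_equal]) auto
qed

lemma inner_slice: "homotopy_equivalence_map Y band (\<lambda>y. a (y, t))"
proof (rule homotopy_equivalence_map_left_cancel[OF cont_a_band band_inclusion])
  show "homotopy_equivalence_map Y (E.tail t) (id \<circ> (\<lambda>y. a (y, t)))"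
    using E.homotopy_equivalence_map_slice[OF t] by (simp add: o_def)
qed

text \<open>Unlike the inner level, this one bounds a tail of the other collar,
  \<open>F.tail s\<close>. Its inclusion into \<open>E.tail t\<close> joins different collars, and
  two-out-of-six is what shows it to be an equivalence.\<close>

lemma outer_slice:
  assumes s': "s \<le> s'" "s' < 1" and ts': "\<And>z. z \<in> topspace Z \<Longrightarrow> u z \<le> t \<Longrightarrow> v z \<le> s'"
  shows "homotopy_equivalence_map Y' band (\<lambda>y. b (y, s))"
proof (rule homotopy_equivalence_map_left_cancel[OF cont_b_band band_inclusion])
  obtain t0 where t0: "0 < t0" "t0 < 1" "\<And>z. z \<in> {z \<in> topspace Z. s \<le> v z} \<Longrightarrow> t0 < u z"
    using E.exists_tail_avoiding[OF F.compact_core[OF s(1)]] by blast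
  \<comment> \<open>Below \<open>t0\<close> the compact core \<open>s \<le> v\<close> is missed, so
    the tail \<open>u \<le> t'\<close> lies inside \<open>v \<le> s\<close>; the minimum also places
    it inside \<open>u \<le> t\<close>.\<close>
  define t' where "t' = min t0 t"
  have t': "0 < t'" "t' \<le> t"
    using t t0 by (auto simp: t'_def)
  have sub: "v z \<le> s" if "z \<in> topspace Z" "u z \<le> t'" for z
    using t0(3)[of z] that by (force simp: t'_def)
  have "homotopy_equivalence_map (F.tail s) (E.tail t) id"
  \<comment> \<open>The chain of tails is \<open>u \<le> t'\<close>, \<open>v \<le> s\<close>,
    \<open>u \<le> t\<close>, \<open>v \<le> s'\<close>. Skipping one term stays within a single
    collar, where the inclusion is an equivalence.\<close>
  proof (rule homotopy_equivalence_map_two_of_six[of "E.tail t'" _ id _ _ "F.tail s'" id])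
    show "continuous_map (E.tail t') (F.tail s) id"
      using sub by (auto simp: E.tail_def F.tail_def continuous_map_in_subtopology continuous_map_from_subtopology)
    show "continuous_map (F.tail s) (E.tail t) id"
      using st by (force simp: E.tail_def F.tail_def continuous_map_in_subtopology continuous_map_from_subtopology)
    show "continuous_map (E.tail t) (F.tail s') id"
      using ts' by (auto simp: E.tail_def F.tail_def continuous_map_in_subtopology continuous_map_from_subtopology)
    show "homotopy_equivalence_map (E.tail t') (E.tail t) (id \<circ> id)"
      using E.homotopy_equivalence_map_tails[OF t' t(2)] by simp
    show "homotopy_equivalence_map (F.tail s) (F.tail s') (id \<circ> id)"
      using F.homotopy_equivalence_map_tails[OF s(1) s'] by simp
  qed
  from homotopy_equivalence_map_compose[OF F.homotopy_equivalence_map_slice[OF s] this]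
  show "homotopy_equivalence_map Y' (E.tail t) (id \<circ> (\<lambda>y. b (y, s)))" .
qed

lemma slices_disjoint: "y \<in> topspace Y \<Longrightarrow> y' \<in> topspace Y' \<Longrightarrow> a (y, t) \<noteq> b (y', s)"
  using E.ua[of y t] F.ua[of y' s] F.a_in[of y' s] st[of "b (y', s)"] t s by force

lemma band_interior_germ:
  assumes "z \<in> topspace band" "u z < t" "s < v z"
  shows "germ_homeomorphic band z Z z"
proof -
  have z: "z \<in> topspace Z" using assms by (simp add: topspace_band)
  have U: "openin Z ({z \<in> topspace Z. u z \<in> {..<t}} \<inter> {z \<in> topspace Z. v z \<in> {s<..}})"
    by (intro openin_Int openin_continuous_map_preimage[OF E.cont_u] openin_continuous_map_preimage[OF F.cont_u]) auto
  have "germ_homeomorphic band z (subtopology Z (topspace Z)) z"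
    unfolding band_def
    by (rule germ_homeomorphic_subspaces[OF U]) (use assms z in auto)
  then show ?thesis by simp
qed

lemma band_inner_germ:
  assumes "z \<in> topspace band" "u z = t"
  shows "germ_homeomorphic band z (prod_topology Y (top_of_set {0::real..})) (\<pi> z, 0)"
proof -
  have z: "z \<in> topspace Z" using assms by (simp add: topspace_band)
  have "s < v z"
    using st[OF z] assms by force
  have U: "openin Z {z \<in> topspace Z. v z \<in> {s<..}}"
    by (intro openin_continuous_map_preimage[OF F.cont_u]) auto
  \<comment> \<open>Near \<open>z\<close> only the wall \<open>u = t\<close> matters since
    \<open>s < v z\<close>, and the region is the side below it, which is the case
    \<open>\<sigma> = - 1\<close>.\<close>
  have "germ_homeomorphic band z (subtopology Z {w \<in> topspace Z. 0 \<le> - 1 * (u w - t) \<and> u w < 1}) z"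
    unfolding band_def
    by (rule germ_homeomorphic_subspaces[OF U]) (use assms z t \<open>s < v z\<close> in auto)
  then show ?thesis
    by (rule germ_homeomorphic_trans) (rule E.level_germ[OF t], use z assms(2) in auto)
qed

lemma band_outer_germ:
  assumes "z \<in> topspace band" "v z = s"
  shows "germ_homeomorphic band z (prod_topology Y' (top_of_set {0::real..})) (\<rho> z, 0)"
proof -
  have z: "z \<in> topspace Z" using assms by (simp add: topspace_band)
  have "u z < t"
    using st[OF z] assms by force
  have U: "openin Z ({z \<in> topspace Z. u z \<in> {..<t}} \<inter> {z \<in> topspace Z. v z \<in> {..<1}})"
    by (intro openin_Int openin_continuous_map_preimage[OF E.cont_u] openin_continuous_map_preimage[OF F.cont_u]) auto
  have "germ_homeomorphic band z (subtopology Z {w \<in> topspace Z. 0 \<le> 1 * (v w - s) \<and> v w < 1}) z"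
    unfolding band_def
    by (rule germ_homeomorphic_subspaces[OF U]) (use assms z s \<open>u z < t\<close> in auto)
  then show ?thesis
    by (rule germ_homeomorphic_trans) (rule F.level_germ[OF s], use z assms(2) in auto)
qed

end

section \<open>The region as a compact manifold with two boundary parts\<close>

lemma closed_manifold_germ:
  assumes "closed_manifold m Y" "y \<in> topspace Y"
  shows "\<exists>q. germ_homeomorphic Y y (Euclidean_space m) q"
  using assms unfolding closed_manifold_def manifold_boundary_def manifold_interior_iff_germ[symmetric]
  by blast

lemma homeomorphic_maps_germ:
  assumes "homeomorphic_maps X Y f g" "x \<in> topspace X"
  shows "germ_homeomorphic X x Y (f x)"
  using germ_homeomorphic_open_embedding[of X Y "topspace Y" f g x] assms by simp

lemma homeomorphic_maps_topological_manifold: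
  assumes h: "homeomorphic_maps X Y f g" and X: "topological_manifold n X"
  shows "topological_manifold n Y"
  unfolding topological_manifold_iff_germ
proof (intro conjI ballI)
  have "X homeomorphic_space Y"
    using h homeomorphic_space_def by blast
  then show "Hausdorff_space Y" "second_countable Y"
    using X homeomorphic_Hausdorff_space homeomorphic_space_second_countability
    by (auto simp: topological_manifold_iff_germ)
  fix y assume y: "y \<in> topspace Y"
  then obtain q where q: "germ_homeomorphic X (g y) (Euclidean_half_space n) q"
    using X homeomorphic_mapsD(4)[OF h] by (auto simp: topological_manifold_iff_germ)
  have "homeomorphic_maps Y X g f"
    using h homeomorphic_maps_sym by blast
  from germ_homeomorphic_trans[OF homeomorphic_maps_germ[OF this y] q]
  show "\<exists>q. germ_homeomorphic Y y (Euclidean_half_space n) q" by blast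
qed

lemma homeomorphic_maps_manifold_boundary:
  assumes h: "homeomorphic_maps X Y f g" and x: "x \<in> topspace X"
  shows "f x \<in> manifold_boundary n Y \<longleftrightarrow> x \<in> manifold_boundary n X"
proof -
  note germ = homeomorphic_maps_germ[OF assms]
  have "(\<exists>q. germ_homeomorphic X x (Euclidean_space n) q) \<longleftrightarrow> (\<exists>q. germ_homeomorphic Y (f x) (Euclidean_space n) q)"
    by (auto intro: germ_homeomorphic_trans[OF germ] germ_homeomorphic_trans[OF germ_homeomorphic_sym[OF germ]])
  then show ?thesis
    using x homeomorphic_mapsD(3)[OF assms] by (simp add: manifold_boundary_def manifold_interior_iff_germ)
qed

text \<open>A continuous bijection from a compact space to a Hausdorff space is a homeomorphism, so
  the inverse need not be examined.\<close>

lemma homeomorphic_map_sum_two: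
  assumes Y: "compact_space Y0" "compact_space Y1" and "Hausdorff_space X"
    and f: "continuous_map Y0 X f0" "continuous_map Y1 X f1"
    and inj: "inj_on f0 (topspace Y0)" "inj_on f1 (topspace Y1)"
    and disj: "\<And>x y. x \<in> topspace Y0 \<Longrightarrow> y \<in> topspace Y1 \<Longrightarrow> f0 x \<noteq> f1 y"
    and onto: "topspace X = f0 ` topspace Y0 \<union> f1 ` topspace Y1"
  shows "homeomorphic_map (sum_topology (\<lambda>b. if b then Y1 else Y0) UNIV) X
           (\<lambda>(b, y). if b then f1 y else f0 y)" (is "homeomorphic_map ?S X ?f")
proof (rule continuous_imp_homeomorphic_map)
  have top: "topspace ?S = Pair False ` topspace Y0 \<union> Pair True ` topspace Y1"
    by (auto split: if_splits)
  show "continuous_map ?S X ?f"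
    unfolding continuous_map_def
  proof (intro conjI allI impI)
    show "?f \<in> topspace ?S \<rightarrow> topspace X"
      unfolding top onto by auto
    fix U assume U: "openin X U"
    have "{y. (i, y) \<in> {x \<in> topspace ?S. ?f x \<in> U}} =
        (if i then {x \<in> topspace Y1. f1 x \<in> U} else {x \<in> topspace Y0. f0 x \<in> U})" for i
      unfolding top by auto
    then have "openin (if i then Y1 else Y0) {y. (i, y) \<in> {x \<in> topspace ?S. ?f x \<in> U}}" for i
      using openin_continuous_map_preimage[OF f(1) U] openin_continuous_map_preimage[OF f(2) U] by simp
    then show "openin ?S {x \<in> topspace ?S. ?f x \<in> U}"
      unfolding openin_sum_topology by auto
  qed
  have "continuous_map Y0 ?S (Pair False)" "continuous_map Y1 ?S (Pair True)"
    using continuous_map_component_injection[of False UNIV "\<lambda>b. if b then Y1 else Y0"]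
      continuous_map_component_injection[of True UNIV "\<lambda>b. if b then Y1 else Y0"] by simp_all
  then have "compactin ?S (Pair False ` topspace Y0)" "compactin ?S (Pair True ` topspace Y1)"
    using Y by (auto intro!: image_compactin simp: compact_space_def)
  then show "compact_space ?S"
    unfolding compact_space_def top by (rule compactin_Un)
  show "?f ` topspace ?S = topspace X"
    unfolding top onto by (simp add: image_Un image_image)
  show "inj_on ?f (topspace ?S)"
    unfolding top using disj disj[symmetric] by (auto intro!: inj_onI dest: inj_onD[OF inj(1)] inj_onD[OF inj(2)])
qed fact

context two_ends
begin

text \<open>\<open>X\<close> is either of the two closed manifolds; its Euclidean germs turn the
  germ of a wall into a half-space germ at depth 0, which settles both the chart and the
  boundary.\<close>

lemma band_level_half_space_germ:
  assumes germ: "germ_homeomorphic band z (prod_topology X (top_of_set {0::real..})) (y, 0)"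
    and X: "closed_manifold m X"
  shows "\<exists>q. germ_homeomorphic band z (Euclidean_half_space (Suc m)) q"
    and "z \<in> manifold_boundary (Suc m) band"
proof -
  have "y \<in> topspace X"
    using germ_homeomorphic_topspace(2)[OF germ] by simp
  then obtain q where q: "germ_homeomorphic X y (Euclidean_space m) q"
    using closed_manifold_germ[OF X] by blast
  have "germ_homeomorphic (prod_topology X (top_of_set {0::real..})) (y, 0)
      (prod_topology (Euclidean_space m) (top_of_set {0::real..})) (q, 0)"
    by (intro germ_homeomorphic_prod q germ_homeomorphic_refl) auto
  note g = germ_homeomorphic_trans[OF germ this]
  show "\<exists>q. germ_homeomorphic band z (Euclidean_half_space (Suc m)) q"
    using germ_homeomorphic_trans[OF g germ_half_space_product] germ_homeomorphic_topspace(2)[OF q] by blast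
  show "z \<in> manifold_boundary (Suc m) band"
    using manifold_boundary_iff_germ[OF g] by simp
qed

lemma topological_manifold_band: "topological_manifold (Suc m) band"
  unfolding topological_manifold_iff_germ
proof (intro conjI ballI)
  show "Hausdorff_space band" "second_countable band"
    unfolding band_def by (simp_all add: Haus second_countable Hausdorff_space_subtopology second_countable_subtopology)
  fix z assume z: "z \<in> topspace band"
  then consider "u z = t" | "v z = s" | "u z < t" "s < v z"
    by (force simp: topspace_band)
  then show "\<exists>q. germ_homeomorphic band z (Euclidean_half_space (Suc m)) q"
  proof cases
    case 1
    then show ?thesis
      using band_level_half_space_germ(1)[OF band_inner_germ[OF z] closed_Y] by blast
  next
    case 2
    then show ?thesis
      using band_level_half_space_germ(1)[OF band_outer_germ[OF z] closed_Y'] by blast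
  next
    case 3
    have "z \<in> topspace Z" using z by (simp add: topspace_band)
    then obtain q where q: "germ_homeomorphic Z z (Euclidean_space (Suc m)) q"
      using germ_Z by blast
    obtain r where r: "germ_homeomorphic (Euclidean_space (Suc m)) q (Euclidean_half_space (Suc m)) r"
      using Euclidean_space_germ_half_space[OF _ germ_homeomorphic_topspace(2)[OF q]] by auto
    show ?thesis
      using germ_homeomorphic_trans[OF germ_homeomorphic_trans[OF band_interior_germ[OF z 3] q] r] by blast
  qed
qed

lemma manifold_boundary_band:
  "manifold_boundary (Suc m) band = (\<lambda>y. a (y, t)) ` topspace Y \<union> (\<lambda>y. b (y, s)) ` topspace Y'"
proof (intro equalityI subsetI)
  fix z assume bd: "z \<in> manifold_boundary (Suc m) band"
  then have z: "z \<in> topspace band" "z \<in> topspace Z"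
    by (auto simp: manifold_boundary_def topspace_band)
  have "\<not> (u z < t \<and> s < v z)"
  proof
    assume *: "u z < t \<and> s < v z"
    obtain q where q: "germ_homeomorphic Z z (Euclidean_space (Suc m)) q"
      using germ_Z[OF z(2)] by blast
    have "germ_homeomorphic band z Z z"
      using band_interior_germ[OF z(1)] * by blast
    from germ_homeomorphic_trans[OF this q] have "z \<in> manifold_interior (Suc m) band"
      unfolding manifold_interior_iff_germ by blast
    then show False
      using bd by (simp add: manifold_boundary_def)
  qed
  then have "u z = t \<or> v z = s"
    using z(1) by (force simp: topspace_band)
  then show "z \<in> (\<lambda>y. a (y, t)) ` topspace Y \<union> (\<lambda>y. b (y, s)) ` topspace Y'"
  proof
    assume "u z = t"
    then have "z = a (\<pi> z, t)" "\<pi> z \<in> topspace Y"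
      using E.a\<pi>u[OF z(2)] E.\<pi>_in[OF z(2)] t by auto
    then show ?thesis by blast
  next
    assume "v z = s"
    then have "z = b (\<rho> z, s)" "\<rho> z \<in> topspace Y'"
      using F.a\<pi>u[OF z(2)] F.\<pi>_in[OF z(2)] s by auto
    then show ?thesis by blast
  qed
next
  fix z assume "z \<in> (\<lambda>y. a (y, t)) ` topspace Y \<union> (\<lambda>y. b (y, s)) ` topspace Y'"
  then show "z \<in> manifold_boundary (Suc m) band"
  proof
    assume "z \<in> (\<lambda>y. a (y, t)) ` topspace Y"
    then have "z \<in> topspace band" "u z = t"
      using a_band E.ua t by auto
    then show ?thesis
      using band_level_half_space_germ(2)[OF band_inner_germ closed_Y] by blast
  next
    assume "z \<in> (\<lambda>y. b (y, s)) ` topspace Y'"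
    then have "z \<in> topspace band" "v z = s"
      using b_band F.ua s by auto
    then show ?thesis
      using band_level_half_space_germ(2)[OF band_outer_germ closed_Y'] by blast
  qed
qed

text \<open>The region is itself the cobordism; it is only copied to the type that
  \<open>h_cobordant\<close> prescribes for its witness, and the two level maps are carried
  along.\<close>

lemma h_cobordant_slices:
  assumes "s \<le> s'" "s' < 1" "\<And>z. z \<in> topspace Z \<Longrightarrow> u z \<le> t \<Longrightarrow> v z \<le> s'"
  shows "h_cobordant m Y Y'"
proof -
  have "second_countable band" "Hausdorff_space band"
    using topological_manifold_band by (auto simp: topological_manifold_def)
  then obtain W :: "(nat \<Rightarrow> real) topology" where "band homeomorphic_space W"
    using second_countable_Hausdorff_homeomorphic_copy by blast
  then obtain \<omega> \<omega>' where \<omega>: "homeomorphic_maps band W \<omega> \<omega>'"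
    unfolding homeomorphic_space_def by blast
  note \<omega>D = homeomorphic_mapsD[OF \<omega>]
  have W: "topological_manifold (Suc m) W"
    using homeomorphic_maps_topological_manifold[OF \<omega> topological_manifold_band] .
  then have HW: "Hausdorff_space W"
    by (simp add: topological_manifold_def)
  have cW: "compact_space W"
    using compact_band homeomorphic_compact_space homeomorphic_space_def \<omega> by blast
  let ?f0 = "\<lambda>y. \<omega> (a (y, t))" and ?f1 = "\<lambda>y. \<omega> (b (y, s))"
  let ?BW = "subtopology W (manifold_boundary (Suc m) W)"
  have bd: "manifold_boundary (Suc m) W = ?f0 ` topspace Y \<union> ?f1 ` topspace Y'"
  proof -
    have "manifold_boundary (Suc m) W = \<omega> ` manifold_boundary (Suc m) band"
    proof (intro equalityI subsetI)
      fix w assume w: "w \<in> manifold_boundary (Suc m) W"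
      then have "w \<in> topspace W" by (simp add: manifold_boundary_def)
      then have "\<omega>' w \<in> topspace band" "\<omega> (\<omega>' w) = w"
        using \<omega>D by auto
      then show "w \<in> \<omega> ` manifold_boundary (Suc m) band"
        using homeomorphic_maps_manifold_boundary[OF \<omega>, of "\<omega>' w" "Suc m"] w by (metis image_eqI)
    next
      fix w assume "w \<in> \<omega> ` manifold_boundary (Suc m) band"
      then show "w \<in> manifold_boundary (Suc m) W"
        using homeomorphic_maps_manifold_boundary[OF \<omega>] by (auto simp: manifold_boundary_def[of _ band])
    qed
    then show ?thesis
      unfolding manifold_boundary_band by auto
  qed
  have topBW: "topspace ?BW = ?f0 ` topspace Y \<union> ?f1 ` topspace Y'"
    unfolding bd[symmetric] by (auto simp: manifold_boundary_def)
  have c0: "continuous_map Y W ?f0"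
    by (rule continuous_map_compose_app[OF \<omega>D(1) cont_a_band])
  have c1: "continuous_map Y' W ?f1"
    by (rule continuous_map_compose_app[OF \<omega>D(1) cont_b_band])
  have inj\<omega>: "\<omega> x = \<omega> y \<longleftrightarrow> x = y" if "x \<in> topspace band" "y \<in> topspace band" for x y
    using \<omega>D(5) that by metis
  have "homeomorphic_map (sum_topology (\<lambda>b. if b then Y' else Y) UNIV) ?BW
          (\<lambda>(c, y). if c then ?f1 y else ?f0 y)"
  proof (rule homeomorphic_map_sum_two)
    show "compact_space Y" "compact_space Y'"
      using closed_Y closed_Y' by (auto simp: closed_manifold_def)
    show "Hausdorff_space ?BW"
      using HW by (rule Hausdorff_space_subtopology)
    show "continuous_map Y ?BW ?f0" "continuous_map Y' ?BW ?f1"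
      using c0 c1 by (auto simp: continuous_map_in_subtopology bd)
    show "inj_on ?f0 (topspace Y)"
    proof (rule inj_onI)
      fix x y assume xy: "x \<in> topspace Y" "y \<in> topspace Y" "?f0 x = ?f0 y"
      then have "a (x, t) = a (y, t)"
        using inj\<omega> a_band by blast
      then show "x = y"
        using E.\<pi>a[OF xy(1) t] E.\<pi>a[OF xy(2) t] by metis
    qed
    show "inj_on ?f1 (topspace Y')"
    proof (rule inj_onI)
      fix x y assume xy: "x \<in> topspace Y'" "y \<in> topspace Y'" "?f1 x = ?f1 y"
      then have "b (x, s) = b (y, s)"
        using inj\<omega> b_band by blast
      then show "x = y"
        using F.\<pi>a[OF xy(1) s] F.\<pi>a[OF xy(2) s] by metis
    qed
    show "?f0 x \<noteq> ?f1 y" if "x \<in> topspace Y" "y \<in> topspace Y'" for x y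
      using inj\<omega> a_band b_band slices_disjoint that by simp
  qed (rule topBW)
  moreover have "homotopy_equivalence_map Y W ?f0"
    using homotopy_equivalence_map_compose[OF inner_slice homeomorphic_imp_homotopy_equivalence_map[OF \<omega>]]
    by (simp add: o_def)
  moreover have "homotopy_equivalence_map Y' W ?f1"
    using homotopy_equivalence_map_compose[OF outer_slice[OF assms] homeomorphic_imp_homotopy_equivalence_map[OF \<omega>]]
    by (simp add: o_def)
  ultimately show ?thesis
    unfolding h_cobordant_def using closed_Y closed_Y' W cW
    by (intro conjI exI[of _ W] exI[of _ "\<lambda>(c, y). if c then ?f1 y else ?f0 y"]) simp_all
qed

end

text \<open>Levels are chosen moving outwards: start at \<open>v = 1/2\<close>, take
  \<open>t\<close> so that the tail \<open>u \<le> t\<close> lies beyond it, then \<open>s\<close>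
  so that the tail \<open>v \<le> s\<close> lies beyond \<open>u = t\<close>.\<close>

lemma h_cobordant_of_two_ends:
  fixes Y Y' :: "'c topology"
  assumes E: "collared_end Z Y a u \<pi>" and F: "collared_end Z Y' b v \<rho>"
    and Z: "Hausdorff_space Z" "second_countable Z"
    and germ: "\<And>z. z \<in> topspace Z \<Longrightarrow> \<exists>q. germ_homeomorphic Z z (Euclidean_space (Suc m)) q"
    and Y: "closed_manifold m Y" "closed_manifold m Y'"
  shows "h_cobordant m Y Y'"
proof -
  obtain t where t: "0 < t" "t < 1" "\<And>z. z \<in> {z \<in> topspace Z. 1/2 \<le> v z} \<Longrightarrow> t < u z"
    using collared_end.exists_tail_avoiding[OF E collared_end.compact_core[OF F, of "1/2"]] by auto
  obtain s0 where s0: "0 < s0" "s0 < 1" "\<And>z. z \<in> {z \<in> topspace Z. t \<le> u z} \<Longrightarrow> s0 < v z"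
    using collared_end.exists_tail_avoiding[OF F collared_end.compact_core[OF E t(1)]] by auto
  \<comment> \<open>The minimum secures \<open>s \<le> 1/2\<close>, the order needed between the
    first and the last level of \<open>v\<close>.\<close>
  define s where "s = min s0 (1/2)"
  have "two_ends Z Y Y' a u \<pi> b v \<rho> m t s"
  proof (intro two_ends.intro two_ends_axioms.intro E F Z germ Y t(1,2))
    show "0 < s" "s < 1"
      using s0 by (auto simp: s_def)
    show "u z < t" if "z \<in> topspace Z" "v z \<le> s" for z
      using s0(3)[of z] that by (force simp: s_def)
  qed
  then show ?thesis
  proof (rule two_ends.h_cobordant_slices[where s' = "1/2"])
    show "v z \<le> 1/2" if "z \<in> topspace Z" "u z \<le> t" for z
      using t(3)[of z] that by force
  qed (auto simp: s_def)
qed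

section \<open>Transporting and constructing collared ends\<close>

lemma collared_end_homeomorphic:
  assumes E: "collared_end Z Y a u \<pi>" and h: "homeomorphic_maps Z Z' f g"
  shows "collared_end Z' Y (\<lambda>x. f (a x)) (\<lambda>z. u (g z)) (\<lambda>z. \<pi> (g z))"
proof
  interpret E: collared_end Z Y a u \<pi> by (rule E)
  note hD = homeomorphic_mapsD[OF h]
  show "continuous_map (prod_topology Y (top_of_set {0<..<1})) Z' (\<lambda>x. f (a x))"
    by (rule continuous_map_compose_app[OF hD(1) E.cont_a])
  show "continuous_map Z' euclideanreal (\<lambda>z. u (g z))"
    by (rule continuous_map_compose_app[OF E.cont_u hD(2)])
  show "0 < u (g z)" if "z \<in> topspace Z'" for z
    using E.u_pos hD(4) that by blast
  have "continuous_map (subtopology Z' {z \<in> topspace Z'. u (g z) < 1}) (subtopology Z {z \<in> topspace Z. u z < 1}) g"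
    using hD(2,4) by (auto simp: continuous_map_in_subtopology continuous_map_from_subtopology)
  then show "continuous_map (subtopology Z' {z \<in> topspace Z'. u (g z) < 1}) Y (\<lambda>z. \<pi> (g z))"
    by (rule continuous_map_compose_app[OF E.cont_\<pi>])
  show "u (g (f (a (y, t)))) = t" "\<pi> (g (f (a (y, t)))) = y" if "y \<in> topspace Y" "0 < t" "t < 1" for y t
    using that hD(5) E.a_in E.ua E.\<pi>a by auto
  show "f (a (\<pi> (g z), u (g z))) = z" if "z \<in> topspace Z'" "u (g z) < 1" for z
    using that hD(4,6) E.a\<pi>u by auto
  show "compactin Z' {z \<in> topspace Z'. t \<le> u (g z)}" if "0 < t" for t
  proof -
    have "{z \<in> topspace Z'. t \<le> u (g z)} = f ` {z \<in> topspace Z. t \<le> u z}"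
    proof (intro equalityI subsetI)
      fix z assume "z \<in> {z \<in> topspace Z'. t \<le> u (g z)}"
      then show "z \<in> f ` {z \<in> topspace Z. t \<le> u z}"
        using hD(4,6) by (intro image_eqI[of _ _ "g z"]) auto
    qed (use hD(3,5) in auto)
    then show ?thesis
      using image_compactin[OF E.compact_core[OF that] hD(1)] by simp
  qed
qed

text \<open>Removing \<open>D\<close>, the level of height 1, leaves an open collar of heights below
  1. The end coordinate is \<open>1 - s\<close>, which tends to 0 towards the removed
  boundary.\<close>

lemma collared_imp_collared_end:
  assumes "collared M D (\<lambda>_. 1)" and D: "D \<subseteq> topspace M" and M: "compact_space M"
  shows "\<exists>a u \<pi>. collared_end (subtopology M (- D)) (subtopology M D) a u \<pi>"
proof -
  let ?E = "collar_extension M D (\<lambda>_. 1)"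
  obtain c s G' where cc: "continuous_map M M c" and cs: "continuous_map M euclideanreal s"
    and cG': "continuous_map ?E M G'"
    and cs_in: "\<And>x. x \<in> topspace M \<Longrightarrow> c x \<in> topspace M \<and> 0 \<le> s x \<and> s x \<le> 1 \<and> (s x = 0 \<or> c x \<in> D)"
    and G'cs: "\<And>x. x \<in> topspace M \<Longrightarrow> G' (c x, s x) = x"
    and sD: "\<And>x. x \<in> topspace M \<Longrightarrow> s x = 1 \<longleftrightarrow> x \<in> D" and cD: "\<And>x. x \<in> D \<Longrightarrow> c x = x"
    and csG': "\<And>z. z \<in> topspace ?E \<Longrightarrow> c (G' z) = fst z \<and> s (G' z) = snd z"
    using collared_coordinates[OF assms(1,2)] by blast
  have inE: "(y, 1 - t) \<in> topspace ?E" if "y \<in> D" "0 < t" "t < 1" for y t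
    using that D by (auto simp: topspace_collar_extension)
  have G'in: "G' (y, 1 - t) \<in> topspace M - D" if "y \<in> D" "0 < t" "t < 1" for y t
  proof -
    have "G' (y, 1 - t) \<in> topspace M" "s (G' (y, 1 - t)) = 1 - t"
      using continuous_map_in[OF cG' inE[OF that]] csG'[OF inE[OF that]] by auto
    then show ?thesis
      using sD that by force
  qed
  have "collared_end (subtopology M (- D)) (subtopology M D) (\<lambda>(y, t). G' (y, 1 - t)) (\<lambda>z. 1 - s z) c"
  proof
    let ?P = "prod_topology (subtopology M D) (top_of_set {0<..<1::real})"
    have "continuous_map ?P M fst" "continuous_map ?P euclideanreal snd"
      using continuous_map_fst[of "subtopology M D" "top_of_set {0<..<1::real}"]
        continuous_map_snd[of "subtopology M D" "top_of_set {0<..<1::real}"]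
      by (auto simp: continuous_map_in_subtopology)
    then have "continuous_map ?P (prod_topology M euclideanreal) (\<lambda>x. (fst x, 1 - snd x))"
      by (auto simp: continuous_map_paired intro!: continuous_map_diff)
    then have "continuous_map ?P ?E (\<lambda>x. (fst x, 1 - snd x))"
      by (auto simp: collar_extension_def continuous_map_in_subtopology)
    then have "continuous_map ?P M (\<lambda>x. G' (fst x, 1 - snd x))"
      by (rule continuous_map_compose_app[OF cG'])
    then show "continuous_map ?P (subtopology M (- D)) (\<lambda>(y, t). G' (y, 1 - t))"
      using G'in by (auto simp: continuous_map_in_subtopology case_prod_unfold)
    show "continuous_map (subtopology M (- D)) euclideanreal (\<lambda>z. 1 - s z)"
      by (intro continuous_map_diff continuous_map_from_subtopology[OF cs]) auto
    show "0 < 1 - s z" if "z \<in> topspace (subtopology M (- D))" for z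
      using that cs_in[of z] sD[of z] by fastforce
    show "continuous_map (subtopology (subtopology M (- D)) {z \<in> topspace (subtopology M (- D)). 1 - s z < 1})
            (subtopology M D) c"
    proof -
      have "c z \<in> D" if "z \<in> topspace M" "0 < s z" for z
        using cs_in[OF that(1)] that(2) by auto
      then show ?thesis
        by (simp add: continuous_map_in_subtopology continuous_map_from_subtopology cc Pi_iff)
    qed
    show "1 - s (case (y, t) of (y, t) \<Rightarrow> G' (y, 1 - t)) = t" "c (case (y, t) of (y, t) \<Rightarrow> G' (y, 1 - t)) = y"
      if "y \<in> topspace (subtopology M D)" "0 < t" "t < 1" for y t
      using csG'[OF inE] that by auto
    show "(case (c z, 1 - s z) of (y, t) \<Rightarrow> G' (y, 1 - t)) = z" if "z \<in> topspace (subtopology M (- D))" for z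
      using G'cs that by simp
    show "compactin (subtopology M (- D)) {z \<in> topspace (subtopology M (- D)). t \<le> 1 - s z}" if "0 < t" for t
    proof -
      \<comment> \<open>For \<open>t > 0\<close> the condition keeps the height below 1, so the set
        misses \<open>D\<close> by itself and its compactness can be checked in
        \<open>M\<close>.\<close>
      have eq: "{z \<in> topspace (subtopology M (- D)). t \<le> 1 - s z} = {z \<in> topspace M. s z \<in> {..1 - t}}"
        using sD that by fastforce
      have "closedin M {z \<in> topspace M. s z \<in> {..1 - t}}"
        by (rule closedin_continuous_map_preimage[OF cs]) auto
      then have "compactin M {z \<in> topspace M. s z \<in> {..1 - t}}"
        using M closedin_compact_space by blast
      moreover have "{z \<in> topspace M. s z \<in> {..1 - t}} \<subseteq> - D"
        unfolding eq[symmetric] by auto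
      ultimately show ?thesis
        unfolding eq compactin_subtopology by simp
    qed
  qed
  then show ?thesis by blast
qed

section \<open>Compact manifolds\<close>

lemma manifold_boundary_collared:
  assumes "topological_manifold (Suc m) M" "compact_space M"
  shows "collared M (manifold_boundary (Suc m) M) (\<lambda>_. 1)"
proof (rule collared_one[OF _ assms(2) closedin_manifold_boundary manifold_boundary_local_collar[OF assms(1)]])
  show "Hausdorff_space M"
    using assms(1) by (simp add: topological_manifold_def)
qed

text \<open>Collars are phrased with the complement of \<open>D\<close>, which may contain points
  outside \<open>M\<close>; the subspace topology ignores those.\<close>

lemma subtopology_manifold_interior:
  "subtopology M (manifold_interior n M) = subtopology M (- manifold_boundary n M)"
proof -
  have "topspace M \<inter> - manifold_boundary n M = manifold_interior n M"
    by (auto simp: manifold_boundary_def manifold_interior_def)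
  then show ?thesis
    by (metis subtopology_restrict)
qed

theorem theorem1:
  fixes N :: nat and J :: "'j set" and C :: "'j \<Rightarrow> 'a topology"
  assumes "N \<ge> 2"
    and "\<And>j. j \<in> J \<Longrightarrow> topological_manifold N (C j)"
    and "\<And>j. j \<in> J \<Longrightarrow> compact_space (C j)"
    and "\<And>j. j \<in> J \<Longrightarrow> topspace (C j) \<noteq> {}"
    and "\<And>j. j \<in> J \<Longrightarrow> contractible_space (C j)"
    and "\<And>j. j \<in> J \<Longrightarrow> connected_space (subtopology (C j) (manifold_boundary N (C j)))"
    and "\<And>i j. i \<in> J \<Longrightarrow> j \<in> J \<Longrightarrow>
           subtopology (C i) (manifold_boundary N (C i))
             homotopy_equivalent_space subtopology (C j) (manifold_boundary N (C j))"
    and "\<And>i j. i \<in> J \<Longrightarrow> j \<in> J \<Longrightarrow> i \<noteq> j \<Longrightarrow>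
           \<not> h_cobordant (N - 1) (subtopology (C i) (manifold_boundary N (C i)))
               (subtopology (C j) (manifold_boundary N (C j)))"
  shows "(\<forall>i \<in> J. \<forall>j \<in> J.
            properly_homotopy_equivalent_space
              (subtopology (C i) (manifold_interior N (C i)))
              (subtopology (C j) (manifold_interior N (C j)))) \<and>
         (\<forall>i \<in> J. \<forall>j \<in> J. i \<noteq> j \<longrightarrow>
            \<not> subtopology (C i) (manifold_interior N (C i))
               homeomorphic_space subtopology (C j) (manifold_interior N (C j)))"
proof -
  obtain m where N: "N = Suc m" "1 \<le> m"
    using \<open>N \<ge> 2\<close> by (cases N) auto
  let ?D = "\<lambda>j. manifold_boundary N (C j)"
  have D: "?D j \<subseteq> topspace (C j)" for j
    by (auto simp: manifold_boundary_def)
  have col: "collared (C j) (?D j) (\<lambda>_. 1)" if "j \<in> J" for j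
    using manifold_boundary_collared[of m "C j"] assms(2,3)[OF that] by (simp add: N)
  have Haus: "Hausdorff_space (C j)" "second_countable (C j)" if "j \<in> J" for j
    using assms(2)[OF that] by (auto simp: topological_manifold_def)
  have "properly_homotopy_equivalent_space (subtopology (C i) (- ?D i)) (subtopology (C j) (- ?D j))"
    if ij: "i \<in> J" "j \<in> J" for i j
  proof -
    obtain u h p where 1: "boundary_pair (C i) (?D i) u h p"
      using collared_imp_boundary_pair[OF col[OF ij(1)] D] by blast
    obtain u' h' p' where 2: "boundary_pair (C j) (?D j) u' h' p'"
      using collared_imp_boundary_pair[OF col[OF ij(2)] D] by blast
    have "two_boundary_pairs (C i) (?D i) u h p (C j) (?D j) u' h' p'"
      by (intro two_boundary_pairs.intro two_boundary_pairs_axioms.intro 1 2 Haus assms(3-5) ij)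
    then show ?thesis
      by (rule two_boundary_pairs.properly_homotopy_equivalent_interiors) (rule assms(7)[OF ij])
  qed
  moreover have "\<not> subtopology (C i) (- ?D i) homeomorphic_space subtopology (C j) (- ?D j)"
    if ij: "i \<in> J" "j \<in> J" "i \<noteq> j" for i j
  proof
    let ?Z = "subtopology (C j) (- ?D j)"
    assume "subtopology (C i) (- ?D i) homeomorphic_space ?Z"
    then obtain f g where fg: "homeomorphic_maps (subtopology (C i) (- ?D i)) ?Z f g"
      unfolding homeomorphic_space_def by blast
    obtain a u \<pi> where E: "collared_end (subtopology (C i) (- ?D i)) (subtopology (C i) (?D i)) a u \<pi>"
      using collared_imp_collared_end[OF col D assms(3)] ij by blast
    obtain b v \<rho> where F: "collared_end ?Z (subtopology (C j) (?D j)) b v \<rho>"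
      using collared_imp_collared_end[OF col D assms(3)] ij by blast
    \<comment> \<open>The collar of the end of \<open>C i\<close> is transported into the interior
      of \<open>C j\<close>, so that both collars belong to one space.\<close>
    have "h_cobordant m (subtopology (C i) (?D i)) (subtopology (C j) (?D j))"
    proof (rule h_cobordant_of_two_ends[OF collared_end_homeomorphic[OF E fg] F])
      show "Hausdorff_space ?Z" "second_countable ?Z"
        using Haus[OF ij(2)] by (simp_all add: Hausdorff_space_subtopology second_countable_subtopology)
      show "closed_manifold m (subtopology (C i) (?D i))" "closed_manifold m (subtopology (C j) (?D j))"
        using closed_manifold_boundary assms(2,3) ij N by auto
      fix z assume "z \<in> topspace ?Z"
      then have z: "z \<in> manifold_interior N (C j)"
        by (auto simp: manifold_boundary_def)
      then obtain q where "germ_homeomorphic (C j) z (Euclidean_space N) q"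
        by (auto simp: manifold_interior_iff_germ)
      then have "germ_homeomorphic (subtopology (C j) (manifold_interior N (C j))) z (Euclidean_space N) q"
        by (rule germ_homeomorphic_trans[OF germ_homeomorphic_open_subtopology[OF openin_manifold_interior z]])
      then show "\<exists>q. germ_homeomorphic ?Z z (Euclidean_space (Suc m)) q"
        unfolding subtopology_manifold_interior N(1) by blast
    qed
    then show False
      using assms(8)[OF ij] N by simp
  qed
  ultimately show ?thesis
    unfolding subtopology_manifold_interior by blast
qed

end
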